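(* Let $G_0=\rho_0(F_2)\simeq\mathbb Z^2$. Then $G_0$ is not a strong limit of groups of the form $\rho(F_2)$ with $\rho\in\mathcal U_2$, i.e. there is no sequence $\rho_j\in\mathcal U_2$ such that $\rho_j(F_2)$ converges strongly to $G_0$. In particular, the density of the set $\{G\in\mathcal D_d:\nu(G)=\infty\}$ in $\mathcal D_d$ for the Zariski–Chabauty topology, with approximating groups taken from the Schottky loci, does not imply density for strong convergence: $G_0\in\mathcal D_2$ is not a strong limit of groups $\rho(F_2)$ with $\rho\in\mathcal U_2$.
   Context: $F_r$ is the free group of rank $r$, $F_2=\langle x_1,x_2\rangle$; $X_r=\mathrm{Hom}(F_r,\mathrm{PSL}(3,\mathbb C))\simeq\mathrm{PSL}(3,\mathbb C)^r$. Strong convergence. A sequence of closed subgroups $G_j\subset\mathrm{PSL}(3,\mathbb C)$ converges geometrically to $G$ if it converges in the classical Chabauty topology on closed subgroups of the Lie group $\mathrm{PSL}(3,\mathbb C)$. $G_j$ converges strongly to a finitely generated group $G$ if $G_j\to G$ geometrically and, for all sufficiently large $j$, there are surjective homomorphisms $\chi_j:G\to G_j$ such that $\chi_j(g)\to g$ for every $g\in G$. The representation $\rho_0$. Let $U$ be a neighborhood of the identity in $\mathrm{PSL}(3,\mathbb C)$ such that, for every discrete subgroup $\Delta\subset\mathrm{PSL}(3,\mathbb C)$, the subgroup generated by $\Delta\cap U$ is nilpotent (a Zassenhaus neighborhood, known to exist). For $t>0$ let $a_t=[\mathrm{diag}(e^t,e^{-t},1)]$, $b_t=[\mathrm{diag}(1,e^t,e^{-t})]$.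 Fix $t>0$ so small that $a_t,b_t\in U$ and define $\rho_0:F_2\to\mathrm{PSL}(3,\mathbb C)$ by $\rho_0(x_1)=a_t$, $\rho_0(x_2)=b_t$. Kulkarni limit set of a discrete $G\subset\mathrm{PSL}(3,\mathbb C)$ acting on $\mathbb P^2_{\mathbb C}$: $L_0(G)$ is the closure of the set of points with infinite stabilizer; $L_1(G)$ is the closure of the set of accumulation points of orbits $Gz$, $z\notin L_0(G)$; $L_2(G)$ is the closure of the set of accumulation points of the families $\{g(K)\}_{g\in G}$ with $K$ compact in $\mathbb P^2_{\mathbb C}\setminus(L_0(G)\cup L_1(G))$. $\Lambda_{\mathrm{Kul}}(G)=L_0\cup L_1\cup L_2$, $\Omega_{\mathrm{Kul}}(G)=\mathbb P^2_{\mathbb C}\setminus\Lambda_{\mathrm{Kul}}(G)$. A complex Kleinian group is a discrete subgroup with $\Omega_{\mathrm{Kul}}(G)\neq\varnothing$. $\mathcal K_r\subset X_r$ is the set of representations whose image is a non-virtually-cyclic complex Kleinian group. $\mathcal D_{\mathrm{fg}}=\{\rho(F_r):r\ge2,\rho\in\mathcal K_r\}$, and $\mathcal D_d$ is its subset of groups $\rho(F_r)$ with $\rho\in\mathcal K_r$, $2\le r\le d$. The Zariski–Chabauty topology on $\mathcal D_{\mathrm{fg}}$ is the final topology induced by the maps $\mathcal K_r\to\mathcal D_{\mathrm{fg}}$, $\rho\mapsto\rho(F_r)$, $r\ge2$, with $\mathcal K_r$ carrying the Zariski topology; $\mathcal D_d$ has the subspace topology. $\mathcal U_2\subset X_2$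 is the Schottky locus: a fixed nonempty subset of $X_2$, open in the usual complex topology, such that every $\rho\in\mathcal U_2$ is injective and $\rho(F_2)$ is a discrete, strongly irreducible, $\theta$-divergent complex Kleinian group, of Schottky type (the elements $\rho(x_i)^{\pm1}$ are proximal and play ping–pong on $\mathbb P^2_{\mathbb C}$), with $\nu(\rho(F_2))=\infty$. (The Schottky loci $\mathcal U_r\subset X_r$ are defined by the same properties for $F_r$.) Here: strongly irreducible means that no finite-index subgroup preserves a point or a projective line of $\mathbb P^2_{\mathbb C}$; $\theta$-divergent means that for every sequence of pairwise distinct elements both gaps $\lambda_1-\lambda_2$ and $\lambda_2-\lambda_3$ of the logarithms $\lambda_1\ge\lambda_2\ge\lambda_3$ of the singular values (of $\mathrm{SL}(3,\mathbb C)$ lifts) tend to $+\infty$; $\nu(G)$ is the supremum of cardinalities of families of projective lines contained in $\Lambda_{\mathrm{Kul}}(G)$ with no three concurrent. *)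

theory Defs
  imports "HOL-Analysis.Analysis" "HOL-Algebra.Elementary_Groups" "HOL-Library.Extended_Nat"
begin

section \<open>Final and quotient topologies\<close>

definition final_topology ::
  "'b set \<Rightarrow> 'i set \<Rightarrow> ('i \<Rightarrow> 'a topology) \<Rightarrow> ('i \<Rightarrow> 'a \<Rightarrow> 'b) \<Rightarrow> 'b topology" where
  "final_topology Y I T f =
     topology (\<lambda>W. W \<subseteq> Y \<and> (\<forall>i\<in>I. openin (T i) {x \<in> topspace (T i). f i x \<in> W}))"

lemma openin_final_topology:
  "openin (final_topology Y I T f) W \<longleftrightarrow>
     W \<subseteq> Y \<and> (\<forall>i\<in>I. openin (T i) {x \<in> topspace (T i). f i x \<in> W})"
proof -
  have *: "{x \<in> topspace (T i). f i x \<in> S \<inter> S'} =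
      {x \<in> topspace (T i). f i x \<in> S} \<inter> {x \<in> topspace (T i). f i x \<in> S'}" for i S S'
    by auto
  have **: "{x \<in> topspace (T i). f i x \<in> \<Union>\<K>} = (\<Union>S\<in>\<K>. {x \<in> topspace (T i). f i x \<in> S})" for i \<K>
    by auto
  have "istopology (\<lambda>W. W \<subseteq> Y \<and> (\<forall>i\<in>I. openin (T i) {x \<in> topspace (T i). f i x \<in> W}))"
    unfolding istopology_def * ** by (auto intro!: openin_Union)
  then show ?thesis
    by (simp add: final_topology_def topology_inverse')
qed

definition quotient_topology :: "'a topology \<Rightarrow> ('a \<Rightarrow> 'b) \<Rightarrow> 'b topology" where
  "quotient_topology X q = final_topology (q ` topspace X) {()} (\<lambda>_. X) (\<lambda>_. q)"


section \<open>The Lie group $\mathrm{PSL}(3,\mathbb{C})$\<close>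

type_synonym mat3 = "complex^3^3"

text \<open>An element of $\mathrm{PSL}(3,\mathbb{C})$ is a coset of the centre, that is, the set of its
  three lifts to $\mathrm{SL}(3,\mathbb{C})$.\<close>
type_synonym psl = "mat3 set"

definition SL3 :: "mat3 monoid" where
  "SL3 = \<lparr>carrier = {A. det A = 1}, monoid.mult = (\<lambda>A B. A ** B), one = mat 1\<rparr>"

definition SL3_center :: "mat3 set" where
  "SL3_center = {mat c | c. c ^ 3 = 1}"

definition PSL3 :: "psl monoid" where
  "PSL3 = SL3 Mod SL3_center"

definition psl_class :: "mat3 \<Rightarrow> psl" where
  "psl_class A = SL3_center #>\<^bsub>SL3\<^esub> A"

definition PSL3_top :: "psl topology" where
  "PSL3_top = quotient_topology (top_of_set (carrier SL3)) psl_class"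

definition diag3 :: "complex \<Rightarrow> complex \<Rightarrow> complex \<Rightarrow> mat3" where
  "diag3 x y z = vector [vector [x, 0, 0], vector [0, y, 0], vector [0, 0, z]]"

definition discrete_subgroup :: "psl set \<Rightarrow> bool" where
  "discrete_subgroup G \<longleftrightarrow> subgroup G PSL3 \<and> subtopology PSL3_top G = discrete_topology G"

definition sub_psl :: "psl set \<Rightarrow> psl monoid" where
  "sub_psl G = PSL3\<lparr>carrier := G\<rparr>"


section \<open>General group theory\<close>

definition finitely_generated :: "('a, 'b) monoid_scheme \<Rightarrow> bool" where
  "finitely_generated G \<longleftrightarrow> (\<exists>S. finite S \<and> S \<subseteq> carrier G \<and> generate G S = carrier G)"

definition finite_index_subgroup :: "'a set \<Rightarrow> ('a, 'b) monoid_scheme \<Rightarrow> bool" where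
  "finite_index_subgroup H G \<longleftrightarrow> subgroup H G \<and> finite (rcosets\<^bsub>G\<^esub> H)"

definition virtually_cyclic :: "('a, 'b) monoid_scheme \<Rightarrow> bool" where
  "virtually_cyclic G \<longleftrightarrow> (\<exists>g\<in>carrier G. finite_index_subgroup (generate G {g}) G)"

fun lower_central :: "('a, 'b) monoid_scheme \<Rightarrow> nat \<Rightarrow> 'a set" where
  "lower_central G 0 = carrier G"
| "lower_central G (Suc n) = generate G
     {h \<otimes>\<^bsub>G\<^esub> k \<otimes>\<^bsub>G\<^esub> inv\<^bsub>G\<^esub> h \<otimes>\<^bsub>G\<^esub> inv\<^bsub>G\<^esub> k | h k. h \<in> lower_central G n \<and> k \<in> carrier G}"

definition nilpotent_group :: "('a, 'b) monoid_scheme \<Rightarrow> bool" where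
  "nilpotent_group G \<longleftrightarrow> (\<exists>n. lower_central G n = {\<one>\<^bsub>G\<^esub>})"

definition zassenhaus_nbhd :: "psl set \<Rightarrow> bool" where
  "zassenhaus_nbhd N \<longleftrightarrow>
     (\<exists>V. openin PSL3_top V \<and> \<one>\<^bsub>PSL3\<^esub> \<in> V \<and> V \<subseteq> N) \<and> N \<subseteq> carrier PSL3 \<and>
     (\<forall>\<Delta>. discrete_subgroup \<Delta> \<longrightarrow> nilpotent_group (sub_psl (generate PSL3 (\<Delta> \<inter> N))))"


section \<open>Free groups and representations\<close>

text \<open>The letter \<open>(i, True)\<close> is the \<open>i\<close>-th generator (counted from 0) and \<open>(i, False)\<close> its inverse;
  \<open>F_r\<close> consists of the reduced words in the letters with \<open>i < r\<close>.\<close>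
type_synonym letter = "nat \<times> bool"

definition letter_inv :: "letter \<Rightarrow> letter" where
  "letter_inv s = (fst s, \<not> snd s)"

definition letters :: "nat \<Rightarrow> letter set" where
  "letters r = {..<r} \<times> UNIV"

definition reduced :: "letter list \<Rightarrow> bool" where
  "reduced w \<longleftrightarrow> successively (\<lambda>s s'. s' \<noteq> letter_inv s) w"

definition red_cons :: "letter \<Rightarrow> letter list \<Rightarrow> letter list" where
  "red_cons s w = (if w \<noteq> [] \<and> hd w = letter_inv s then tl w else s # w)"

definition free_group :: "nat \<Rightarrow> letter list monoid" where
  "free_group r = \<lparr>carrier = {w. set w \<subseteq> letters r \<and> reduced w},
                   monoid.mult = foldr red_cons, one = []\<rparr>"

definition gen :: "nat \<Rightarrow> letter list" where
  "gen i = [(i, True)]"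

type_synonym rep = "letter list \<Rightarrow> psl"

text \<open>\<open>X_r\<close>; extensionality makes a homomorphism on \<open>F_r\<close> a unique HOL function, so that
  evaluation at the generators identifies \<open>X_r\<close> with the extensional \<open>r\<close>-tuples.\<close>
definition rep_space :: "nat \<Rightarrow> rep set" where
  "rep_space r = hom (free_group r) PSL3 \<inter> extensional (carrier (free_group r))"

definition rep_image :: "nat \<Rightarrow> rep \<Rightarrow> psl set" where
  "rep_image r \<rho> = \<rho> ` carrier (free_group r)"

definition gen_values :: "nat \<Rightarrow> rep \<Rightarrow> nat \<Rightarrow> psl" where
  "gen_values r \<rho> = (\<lambda>i\<in>{..<r}. \<rho> (gen i))"

definition rep_top :: "nat \<Rightarrow> rep topology" where
  "rep_top r = pullback_topology (rep_space r) (gen_values r)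
                 (product_topology (\<lambda>_. PSL3_top) {..<r})"

text \<open>Regular functions on $\mathrm{SL}(3,\mathbb{C})^r$ are the restrictions of polynomials in the
  \<open>9r\<close> matrix entries. $\mathrm{PSL}(3,\mathbb{C})^r$ is the quotient of the affine variety
  $\mathrm{SL}(3,\mathbb{C})^r$ by the finite group $\mu_3^r$, so its Zariski topology is the
  quotient of the Zariski topology upstairs.\<close>
inductive entry_polynomial :: "nat \<Rightarrow> ((nat \<Rightarrow> mat3) \<Rightarrow> complex) \<Rightarrow> bool" for r where
  const: "entry_polynomial r (\<lambda>A. c)"
| entry: "k < r \<Longrightarrow> entry_polynomial r (\<lambda>A. A k $ i $ j)"
| add: "entry_polynomial r p \<Longrightarrow> entry_polynomial r q \<Longrightarrow> entry_polynomial r (\<lambda>A. p A + q A)"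
| mult: "entry_polynomial r p \<Longrightarrow> entry_polynomial r q \<Longrightarrow> entry_polynomial r (\<lambda>A. p A * q A)"

definition SL3_power_zariski :: "nat \<Rightarrow> (nat \<Rightarrow> mat3) topology" where
  "SL3_power_zariski r = topology_generated_by
     {{A \<in> {..<r} \<rightarrow>\<^sub>E carrier SL3. p A \<noteq> 0} | p. entry_polynomial r p}"

definition PSL3_power_zariski :: "nat \<Rightarrow> (nat \<Rightarrow> psl) topology" where
  "PSL3_power_zariski r =
     quotient_topology (SL3_power_zariski r) (\<lambda>A. \<lambda>i\<in>{..<r}. psl_class (A i))"

definition rep_zariski :: "nat \<Rightarrow> rep topology" where
  "rep_zariski r = pullback_topology (rep_space r) (gen_values r) (PSL3_power_zariski r)"


section \<open>Chabauty topology and strong convergence\<close>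

definition closed_subgroups :: "psl set set" where
  "closed_subgroups = {G. subgroup G PSL3 \<and> closedin PSL3_top G}"

definition chabauty_top :: "psl set topology" where
  "chabauty_top = topology_generated_by
     ({{G \<in> closed_subgroups. G \<inter> K = {}} | K. compactin PSL3_top K} \<union>
      {{G \<in> closed_subgroups. G \<inter> V \<noteq> {}} | V. openin PSL3_top V})"

definition converges_strongly :: "(nat \<Rightarrow> psl set) \<Rightarrow> psl set \<Rightarrow> bool" where
  "converges_strongly Gs G \<longleftrightarrow>
     finitely_generated (sub_psl G) \<and>
     limitin chabauty_top Gs G sequentially \<and>
     (\<exists>h. (\<forall>\<^sub>F j in sequentially. h j \<in> epi (sub_psl G) (sub_psl (Gs j))) \<and>
          (\<forall>g\<in>G. limitin PSL3_top (\<lambda>j. h j g) g sequentially))"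


section \<open>The complex projective plane\<close>

text \<open>A point of $\mathbb{P}^2_{\mathbb{C}}$ is a one-dimensional subspace of $\mathbb{C}^3$;
  \<open>vec.span\<close> is the complex span.\<close>
type_synonym pt = "(complex^3) set"

definition proj_point :: "complex^3 \<Rightarrow> pt" where
  "proj_point v = vec.span {v}"

definition P2_top :: "pt topology" where
  "P2_top = quotient_topology (top_of_set (UNIV - {0})) proj_point"

definition P2 :: "pt set" where
  "P2 = proj_point ` (UNIV - {0})"

definition proj_line :: "pt set \<Rightarrow> bool" where
  "proj_line l \<longleftrightarrow> (\<exists>W. vec.subspace W \<and> vec.dim W = 2 \<and> l = {p \<in> P2. p \<subseteq> W})"

text \<open>All lifts of \<open>g\<close> differ by scalars, hence map the subspace \<open>p\<close> to the same subspace.\<close>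
definition act :: "psl \<Rightarrow> pt \<Rightarrow> pt" where
  "act g p = {A *v x | A x. A \<in> g \<and> x \<in> p}"


section \<open>The Kulkarni limit set\<close>

text \<open>Cluster points of the family \<open>{g(K)}\<close> indexed by \<open>g \<in> G\<close>.\<close>
definition family_cluster :: "psl set \<Rightarrow> pt set \<Rightarrow> pt set" where
  "family_cluster G K = {p \<in> P2. \<forall>N. openin P2_top N \<and> p \<in> N \<longrightarrow>
                                   infinite {g \<in> G. act g ` K \<inter> N \<noteq> {}}}"

definition Kul0 :: "psl set \<Rightarrow> pt set" where
  "Kul0 G = P2_top closure_of {p \<in> P2. infinite {g \<in> G. act g p = p}}"

definition Kul1 :: "psl set \<Rightarrow> pt set" where
  "Kul1 G = P2_top closure_of (\<Union>z \<in> P2 - Kul0 G. P2_top derived_set_of ((\<lambda>g. act g z) ` G))"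

definition Kul2 :: "psl set \<Rightarrow> pt set" where
  "Kul2 G = P2_top closure_of
     (\<Union>K \<in> {K. compactin P2_top K \<and> K \<subseteq> P2 - (Kul0 G \<union> Kul1 G)}. family_cluster G K)"

definition Kul_limit_set :: "psl set \<Rightarrow> pt set" where
  "Kul_limit_set G = Kul0 G \<union> Kul1 G \<union> Kul2 G"

definition Kul_domain :: "psl set \<Rightarrow> pt set" where
  "Kul_domain G = P2 - Kul_limit_set G"

definition complex_kleinian :: "psl set \<Rightarrow> bool" where
  "complex_kleinian G \<longleftrightarrow> discrete_subgroup G \<and> Kul_domain G \<noteq> {}"

definition no_three_concurrent :: "pt set set \<Rightarrow> bool" where
  "no_three_concurrent L \<longleftrightarrow>
     (\<forall>l1\<in>L. \<forall>l2\<in>L. \<forall>l3\<in>L. distinct [l1, l2, l3] \<longrightarrow> l1 \<inter> l2 \<inter> l3 = {})"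

definition nu :: "psl set \<Rightarrow> enat" where
  "nu G = (SUP L \<in> {L. (\<forall>l\<in>L. proj_line l \<and> l \<subseteq> Kul_limit_set G) \<and> no_three_concurrent L}.
             if finite L then enat (card L) else \<infinity>)"


section \<open>The spaces of groups\<close>

definition kleinian_reps :: "nat \<Rightarrow> rep set" where
  "kleinian_reps r = {\<rho> \<in> rep_space r. complex_kleinian (rep_image r \<rho>) \<and>
                                     \<not> virtually_cyclic (sub_psl (rep_image r \<rho>))}"

definition D_fg :: "psl set set" where
  "D_fg = {rep_image r \<rho> | r \<rho>. 2 \<le> r \<and> \<rho> \<in> kleinian_reps r}"

definition D_rank :: "nat \<Rightarrow> psl set set" where
  "D_rank d = {rep_image r \<rho> | r \<rho>. 2 \<le> r \<and> r \<le> d \<and> \<rho> \<in> kleinian_reps r}"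

definition zariski_chabauty_top :: "psl set topology" where
  "zariski_chabauty_top =
     final_topology D_fg {2..} (\<lambda>r. subtopology (rep_zariski r) (kleinian_reps r)) rep_image"


section \<open>Schottky loci\<close>

definition strongly_irreducible :: "psl set \<Rightarrow> bool" where
  "strongly_irreducible G \<longleftrightarrow>
     (\<forall>H. finite_index_subgroup H (sub_psl G) \<longrightarrow>
        \<not> (\<exists>p\<in>P2. \<forall>h\<in>H. act h p = p) \<and>
        \<not> (\<exists>l. proj_line l \<and> (\<forall>h\<in>H. act h ` l = l)))"

definition conj_transpose :: "mat3 \<Rightarrow> mat3" where
  "conj_transpose A = (\<chi> i j. cnj (A $ j $ i))"

text \<open>Square roots of the eigenvalues of \<open>A\<^sup>*A\<close>, with multiplicity and in decreasing order.\<close>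
definition singular_values :: "mat3 \<Rightarrow> real^3" where
  "singular_values A = (THE s. s $ 1 \<ge> s $ 2 \<and> s $ 2 \<ge> s $ 3 \<and> s $ 3 \<ge> 0 \<and>
     (\<forall>x. det (mat x - conj_transpose A ** A) = (\<Prod>i\<in>UNIV. x - of_real ((s $ i)\<^sup>2))))"

text \<open>The choice of lift is immaterial: the lifts differ by cube roots of unity.\<close>
definition log_sv :: "psl \<Rightarrow> 3 \<Rightarrow> real" where
  "log_sv g i = ln (singular_values (SOME A. A \<in> g) $ i)"

definition theta_divergent :: "psl set \<Rightarrow> bool" where
  "theta_divergent G \<longleftrightarrow>
     (\<forall>g :: nat \<Rightarrow> psl. inj g \<and> range g \<subseteq> G \<longrightarrow>
        filterlim (\<lambda>n. log_sv (g n) 1 - log_sv (g n) 2) at_top sequentially \<and>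
        filterlim (\<lambda>n. log_sv (g n) 2 - log_sv (g n) 3) at_top sequentially)"

text \<open>\<open>p\<close> is the eigenline of an eigenvalue \<open>a\<close> of (a lift of) \<open>g\<close> that is strictly larger in
  modulus than the other two eigenvalues \<open>b\<close>, \<open>c\<close>, counted with algebraic multiplicity.\<close>
definition attracting_point :: "psl \<Rightarrow> pt \<Rightarrow> bool" where
  "attracting_point g p \<longleftrightarrow>
     (\<exists>A\<in>g. \<exists>a b c v. (\<forall>x. det (mat x - A) = (x - a) * (x - b) * (x - c)) \<and>
        norm b < norm a \<and> norm c < norm a \<and> v \<noteq> 0 \<and> A *v v = a *s v \<and> p = proj_point v)"

definition proximal :: "psl \<Rightarrow> bool" where
  "proximal g \<longleftrightarrow> (\<exists>p. attracting_point g p)"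

text \<open>Ping-pong: pairwise disjoint open neighbourhoods \<open>B s\<close> of the attracting points of the
  \<open>\<rho>(s)\<close>, one for each letter \<open>s\<close>, such that \<open>\<rho>(s)\<close> maps every \<open>B s'\<close> other than
  \<open>B (letter_inv s)\<close> into \<open>B s\<close>.\<close>
definition schottky_type :: "nat \<Rightarrow> rep \<Rightarrow> bool" where
  "schottky_type r \<rho> \<longleftrightarrow>
     (\<forall>s\<in>letters r. proximal (\<rho> [s])) \<and>
     (\<exists>B :: letter \<Rightarrow> pt set.
        (\<forall>s\<in>letters r. openin P2_top (B s) \<and> (\<forall>p. attracting_point (\<rho> [s]) p \<longrightarrow> p \<in> B s)) \<and>
        (\<forall>s\<in>letters r. \<forall>s'\<in>letters r. s \<noteq> s' \<longrightarrow> B s \<inter> B s' = {}) \<and>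
        (\<forall>s\<in>letters r. \<forall>s'\<in>letters r. s' \<noteq> letter_inv s \<longrightarrow> act (\<rho> [s]) ` B s' \<subseteq> B s))"

definition schottky_locus :: "nat \<Rightarrow> rep set \<Rightarrow> bool" where
  "schottky_locus r \<U> \<longleftrightarrow>
     \<U> \<noteq> {} \<and> openin (rep_top r) \<U> \<and>
     (\<forall>\<rho>\<in>\<U>. inj_on \<rho> (carrier (free_group r)) \<and>
        complex_kleinian (rep_image r \<rho>) \<and>
        strongly_irreducible (rep_image r \<rho>) \<and>
        theta_divergent (rep_image r \<rho>) \<and>
        schottky_type r \<rho> \<and>
        nu (rep_image r \<rho>) = \<infinity>)"

definition schottky_groups :: "(nat \<Rightarrow> rep set) \<Rightarrow> nat \<Rightarrow> psl set set" where
  "schottky_groups \<U> d = {rep_image r \<rho> | r \<rho>. 2 \<le> r \<and> r \<le> d \<and> \<rho> \<in> \<U> r}"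

end

theory Submission
  imports Defs "HOL-Computational_Algebra.Polynomial"
begin

text \<open>A strong limit is a group of which the approximating groups are eventually quotients. The group
  \<open>G0\<close> is abelian, whereas the image of a faithful representation of a free group of rank at least 2
  is not, so no such limit exists.

  \<open>G0\<close> is the lattice of diagonal elements with entries \<open>(exp(tm), exp(t(n-m)), exp(-tn))\<close>. Only
  finitely many of these return a region of the projective plane in which the ratios of the moduli
  of the coordinates are bounded to itself, so the Kulkarni limit set consists of the three
  coordinate lines, all of whose points have infinite stabilizers.

  A classically open nonempty set of representations is Zariski dense: join a tuple \<open>A\<close> in that set
  to an arbitrary tuple \<open>B\<close> by a segment of matrices and divide the first columns by the determinants.
  This is a rational curve in the group, and a polynomial that vanishes on the open set vanishes on
  the curve near \<open>A\<close>, hence at \<open>B\<close>.\<close>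

section \<open>The group $\mathrm{PSL}(3,\mathbb{C})$\<close>

text \<open>A quantity on the group must be blind to the choice among the three lifts of an element.
  Moduli of matrix entries are, and they both separate and isolate the points of the lattice.
  Density passes to the space of groups because its topology is final. A neighbourhood of a group G
  pulls back to a relatively open subset of \<open>kleinian_reps r\<close> for a rank r that
  realizes G, and this subset is the trace of a Zariski open set of representations. The Schottky
  locus of rank r meets that open set and lies inside \<open>kleinian_reps r\<close>, so it meets
  the trace. The inclusion requires that Schottky groups are not virtually cyclic; faithfulness
  gives this, since positive powers of two free generators never commute. The obstacle in the
  density argument is that a segment between matrices of determinant 1 leaves SL(3,C), and its
  normalization has poles. After clearing denominators the pulled back polynomial becomes a
  polynomial on all of C, so the poles do not separate the two ends.\<close>

lemma mat_mult_nth: "(mat c ** A) $ i $ j = c * A $ i $ j" for A :: mat3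
  by (simp add: matrix_matrix_mult_def mat_def if_distrib[of "\<lambda>x. x * _"] cong: if_cong)

lemma mult_mat_nth: "(A ** mat c) $ i $ j = c * A $ i $ j" for A :: mat3
  by (simp add: matrix_matrix_mult_def mat_def if_distrib[of "\<lambda>x. _ * x"] mult.commute cong: if_cong)

lemma mat_mult_commute: "mat c ** A = A ** mat c" for A :: mat3
  by (simp add: vec_eq_iff mat_mult_nth mult_mat_nth)

lemma mat_mult_mat: "mat c ** mat d = (mat (c * d) :: mat3)"
  by (simp add: vec_eq_iff mat_mult_nth) (simp add: mat_def)

lemma det_mat3: "det (mat c :: mat3) = c ^ 3"
  by (simp add: det_3 mat_def power3_eq_cube)

lemma group_SL3: "group SL3"
proof (rule groupI)
  fix A assume A: "A \<in> carrier SL3"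
  then have d: "det A = 1" by (simp add: SL3_def)
  then have "invertible A" by (simp add: invertible_det_nz)
  then obtain B where B: "A ** B = mat 1" "B ** A = mat 1" by (auto simp: invertible_def)
  then have "det A * det B = 1" by (metis det_mul det_I)
  then show "\<exists>B\<in>carrier SL3. B \<otimes>\<^bsub>SL3\<^esub> A = \<one>\<^bsub>SL3\<^esub>"
    using B d by (auto simp: SL3_def)
qed (auto simp: SL3_def det_mul matrix_mul_assoc)

interpretation SL3: group SL3 by (rule group_SL3)

lemma SL3_simps [simp]:
  "A \<in> carrier SL3 \<longleftrightarrow> det A = 1" "A \<otimes>\<^bsub>SL3\<^esub> B = A ** B" "\<one>\<^bsub>SL3\<^esub> = mat 1"
  by (auto simp: SL3_def)

lemma normal_SL3_center: "SL3_center \<lhd> SL3"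
proof (rule SL3.normalI)
  show "subgroup SL3_center SL3"
  proof (rule SL3.subgroupI)
    show "SL3_center \<subseteq> carrier SL3" "SL3_center \<noteq> {}"
      by (auto simp: SL3_center_def det_mat3 intro: exI[of _ 1])
  next
    fix A assume "A \<in> SL3_center"
    then obtain c where c: "A = mat c" "c ^ 3 = 1" by (auto simp: SL3_center_def)
    then have "c * (inverse c) = 1" by (cases "c = 0") auto
    then have "inv\<^bsub>SL3\<^esub> A = mat (inverse c)"
      using c by (intro SL3.inv_equality) (auto simp: mat_mult_mat det_mat3 power_inverse mult.commute)
    then show "inv\<^bsub>SL3\<^esub> A \<in> SL3_center"
      using c by (auto simp: SL3_center_def power_inverse)
  next
    fix A B assume "A \<in> SL3_center" "B \<in> SL3_center"
    then show "A \<otimes>\<^bsub>SL3\<^esub> B \<in> SL3_center"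
      by (auto simp: SL3_center_def mat_mult_mat power_mult_distrib)
  qed
  show "\<forall>x\<in>carrier SL3. SL3_center #>\<^bsub>SL3\<^esub> x = x <#\<^bsub>SL3\<^esub> SL3_center"
    by (auto simp: r_coset_def l_coset_def SL3_center_def mat_mult_commute)
qed

interpretation SL3_center: normal SL3_center SL3 by (rule normal_SL3_center)

lemma group_PSL3: "group PSL3"
  unfolding PSL3_def by (rule SL3_center.factorgroup_is_group)

interpretation PSL3: group PSL3 by (rule group_PSL3)

lemma carrier_PSL3: "carrier PSL3 = psl_class ` carrier SL3"
  by (auto simp: PSL3_def FactGroup_def RCOSETS_def psl_class_def)

lemma psl_class_in_PSL3: "det A = 1 \<Longrightarrow> psl_class A \<in> carrier PSL3"
  by (auto simp: carrier_PSL3)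

lemma psl_class_eq: "psl_class A = (\<lambda>c. mat c ** A) ` {c. c ^ 3 = 1}"
  by (auto simp: psl_class_def r_coset_def SL3_center_def)

lemma psl_class_self: "A \<in> psl_class A"
  by (auto simp: psl_class_eq intro!: image_eqI[of _ _ 1])

lemma psl_class_mult:
  "det A = 1 \<Longrightarrow> det B = 1 \<Longrightarrow> psl_class A \<otimes>\<^bsub>PSL3\<^esub> psl_class B = psl_class (A ** B)"
  using SL3_center.rcos_sum[of A B] by (simp add: PSL3_def FactGroup_def psl_class_def)

lemma psl_class_one: "psl_class (mat 1) = \<one>\<^bsub>PSL3\<^esub>"
  using SL3.coset_mult_one[OF SL3_center.subset] by (simp add: PSL3_def FactGroup_def psl_class_def)

lemma norm_cube_root_of_unity: "c ^ 3 = 1 \<Longrightarrow> norm c = 1" for c :: complex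
  by (metis norm_ge_zero norm_one norm_power power_eq_1_iff zero_neq_numeral)

section \<open>Topology and subgroups of $\mathrm{PSL}(3,\mathbb{C})$\<close>

lemma openin_quotient_topology:
  "openin (quotient_topology X q) W \<longleftrightarrow> W \<subseteq> q ` topspace X \<and> openin X {x \<in> topspace X. q x \<in> W}"
  by (simp add: quotient_topology_def openin_final_topology)

lemma topspace_quotient_topology: "topspace (quotient_topology X q) = q ` topspace X"
proof -
  have "{x \<in> topspace X. q x \<in> q ` topspace X} = topspace X" by auto
  then have "openin (quotient_topology X q) (q ` topspace X)"
    by (simp add: openin_quotient_topology)
  then have "q ` topspace X \<subseteq> topspace (quotient_topology X q)"
    by (rule openin_subset)
  moreover have "topspace (quotient_topology X q) \<subseteq> q ` topspace X"
    using openin_topspace[of "quotient_topology X q"] unfolding openin_quotient_topology by blast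
  ultimately show ?thesis by (rule subset_antisym[rotated])
qed

lemma continuous_map_quotient_topology: "continuous_map X (quotient_topology X q) q"
  by (auto simp: continuous_map_def topspace_quotient_topology openin_quotient_topology)

lemma topspace_PSL3_top: "topspace PSL3_top = carrier PSL3"
  by (simp add: PSL3_top_def topspace_quotient_topology carrier_PSL3)

lemma openin_PSL3_top:
  "openin PSL3_top W \<longleftrightarrow> W \<subseteq> carrier PSL3 \<and> openin (top_of_set (carrier SL3)) {A \<in> carrier SL3. psl_class A \<in> W}"
  by (simp add: PSL3_top_def openin_quotient_topology carrier_PSL3)

section \<open>Subgroups as groups, and powers in virtually cyclic groups\<close>

lemma sub_psl_simps [simp]:
  "carrier (sub_psl G) = G" "x \<otimes>\<^bsub>sub_psl G\<^esub> y = x \<otimes>\<^bsub>PSL3\<^esub> y" "\<one>\<^bsub>sub_psl G\<^esub> = \<one>\<^bsub>PSL3\<^esub>"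
  by (simp_all add: sub_psl_def)

lemma group_sub_psl: "subgroup G PSL3 \<Longrightarrow> group (sub_psl G)"
  unfolding sub_psl_def by (rule PSL3.subgroup_imp_group)

text \<open>Pigeonhole on the cosets of the powers of \<open>h\<close>.\<close>
lemma (in group) finite_index_power_mem:
  assumes "finite_index_subgroup H G" "h \<in> carrier G"
  obtains k :: nat where "k > 0" "h [^] k \<in> H"
proof -
  have H: "subgroup H G" and fin: "finite (rcosets H)"
    using assms(1) by (auto simp: finite_index_subgroup_def)
  have "(\<lambda>n::nat. H #> h [^] n) ` UNIV \<subseteq> rcosets H"
    using assms(2) by (auto simp: RCOSETS_def)
  then have "finite (range (\<lambda>n::nat. H #> h [^] n))"
    using fin finite_subset by blast
  then have "\<not> inj (\<lambda>n::nat. H #> h [^] n)"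
    using finite_imageD infinite_UNIV_nat by blast
  then obtain m n :: nat where mn: "m < n" "H #> h [^] m = H #> h [^] n"
    by (auto simp: inj_def) (metis linorder_neqE_nat)
  have "h [^] n \<in> H #> h [^] m"
    using mn assms(2) H by (intro repr_independenceD) auto
  then obtain u where u: "u \<in> H" "h [^] n = u \<otimes> h [^] m"
    by (auto simp: r_coset_def)
  have "h [^] n = h [^] (n - m) \<otimes> h [^] m"
    using mn assms(2) by (simp add: nat_pow_mult)
  then have "h [^] (n - m) = u"
    using u assms(2) subgroup.subset[OF H] by (metis nat_pow_closed right_cancel subsetD)
  with u mn that[of "n - m"] show thesis by auto
qed

text \<open>Suitable positive powers of any two elements fall into the same cyclic subgroup of
  finite index. This serves both exclusions of virtual cyclicity: for free images such powers would
  commute, and for the lattice two independent directions would be multiples of one vector.\<close>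

lemma (in group) virtually_cyclic_powers:
  assumes "virtually_cyclic G" "x \<in> carrier G" "y \<in> carrier G"
  obtains g and k l :: nat and p q :: int where "g \<in> carrier G" "k > 0" "l > 0"
    "x [^] k = g [^] p" "y [^] l = g [^] q"
proof -
  obtain g where g: "g \<in> carrier G" "finite_index_subgroup (generate G {g}) G"
    using assms(1) by (auto simp: virtually_cyclic_def)
  obtain k :: nat where k: "k > 0" "x [^] k \<in> generate G {g}"
    using finite_index_power_mem[OF g(2) assms(2)] .
  obtain l :: nat where l: "l > 0" "y [^] l \<in> generate G {g}"
    using finite_index_power_mem[OF g(2) assms(3)] .
  obtain p q :: int where "x [^] k = g [^] p" "y [^] l = g [^] q"
    using k(2) l(2) unfolding generate_pow[OF g(1)] by blast
  then show thesis by (rule that[OF g(1) k(1) l(1)])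
qed

section \<open>Free groups and their representations\<close>

lemma carrier_free_group: "w \<in> carrier (free_group r) \<longleftrightarrow> set w \<subseteq> letters r \<and> reduced w"
  by (simp add: free_group_def)

lemma free_group_mult: "x \<otimes>\<^bsub>free_group r\<^esub> y = foldr red_cons x y"
  by (simp add: free_group_def)

lemma reduced_Nil [simp]: "reduced []"
  by (simp add: reduced_def)

lemma reduced_Cons: "reduced (s # w) \<longleftrightarrow> (w = [] \<or> hd w \<noteq> letter_inv s) \<and> reduced w"
  by (cases w) (auto simp: reduced_def)

lemma letter_inv_letter_inv [simp]: "letter_inv (letter_inv s) = s"
  by (simp add: letter_inv_def)

lemma letter_inv_in_letters [simp]: "letter_inv s \<in> letters r \<longleftrightarrow> s \<in> letters r"
  by (simp add: letter_inv_def letters_def mem_Times_iff)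

lemma red_cons_closed:
  "s \<in> letters r \<Longrightarrow> w \<in> carrier (free_group r) \<Longrightarrow> red_cons s w \<in> carrier (free_group r)"
  by (cases w) (auto simp: red_cons_def carrier_free_group reduced_Cons)

lemma foldr_red_cons_closed:
  "set v \<subseteq> letters r \<Longrightarrow> w \<in> carrier (free_group r) \<Longrightarrow> foldr red_cons v w \<in> carrier (free_group r)"
  by (induction v) (auto intro: red_cons_closed)

lemma singleton_in_free_group [simp]: "[s] \<in> carrier (free_group r) \<longleftrightarrow> s \<in> letters r"
  by (auto simp: carrier_free_group reduced_def)

lemma Nil_in_free_group [simp]: "[] \<in> carrier (free_group r)"
  by (auto simp: carrier_free_group reduced_def)

lemma rep_space_closed:
  "\<rho> \<in> rep_space r \<Longrightarrow> w \<in> carrier (free_group r) \<Longrightarrow> \<rho> w \<in> carrier PSL3"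
  by (auto simp: rep_space_def hom_def)

lemma rep_Cons:
  assumes "\<rho> \<in> rep_space r" "s # w \<in> carrier (free_group r)"
  shows "\<rho> (s # w) = \<rho> [s] \<otimes>\<^bsub>PSL3\<^esub> \<rho> w"
proof -
  \<comment> \<open>Reducedness of \<open>s # w\<close> makes \<open>red_cons\<close> prepend the
    letter instead of cancelling it.\<close>
  have "s # w = [s] \<otimes>\<^bsub>free_group r\<^esub> w"
    using assms(2) by (auto simp: free_group_mult red_cons_def carrier_free_group reduced_Cons)
  moreover have "[s] \<in> carrier (free_group r)" "w \<in> carrier (free_group r)"
    using assms(2) by (auto simp: carrier_free_group reduced_Cons)
  ultimately show ?thesis
    using assms(1) by (auto simp: rep_space_def hom_def)
qed

lemma rep_Nil:
  assumes "\<rho> \<in> rep_space r"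
  shows "\<rho> [] = \<one>\<^bsub>PSL3\<^esub>"
proof -
  have "\<rho> ([] \<otimes>\<^bsub>free_group r\<^esub> []) = \<rho> [] \<otimes>\<^bsub>PSL3\<^esub> \<rho> []"
    using assms by (simp add: rep_space_def hom_def)
  then show ?thesis
    using rep_space_closed[OF assms] by (simp add: free_group_mult)
qed

lemma rep_letter_inv:
  assumes "\<rho> \<in> rep_space r" "s \<in> letters r"
  shows "\<rho> [letter_inv s] = inv\<^bsub>PSL3\<^esub> (\<rho> [s])"
proof -
  have "\<rho> ([letter_inv s] \<otimes>\<^bsub>free_group r\<^esub> [s]) = \<rho> [letter_inv s] \<otimes>\<^bsub>PSL3\<^esub> \<rho> [s]"
    using assms by (simp add: rep_space_def hom_def)
  then have "\<rho> [letter_inv s] \<otimes>\<^bsub>PSL3\<^esub> \<rho> [s] = \<one>\<^bsub>PSL3\<^esub>"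
    by (simp add: free_group_mult red_cons_def rep_Nil[OF assms(1)])
  then show ?thesis
    using assms by (intro PSL3.inv_equality[symmetric]) (auto intro: rep_space_closed)
qed

lemma rep_replicate_append:
  assumes "\<rho> \<in> rep_space r" "replicate k s @ w \<in> carrier (free_group r)" "s \<in> letters r"
  shows "\<rho> (replicate k s @ w) = \<rho> [s] [^]\<^bsub>PSL3\<^esub> k \<otimes>\<^bsub>PSL3\<^esub> \<rho> w"
  using assms(2)
proof (induction k)
  case 0
  then show ?case using assms by (simp add: rep_space_closed)
next
  case (Suc k)
  have w: "w \<in> carrier (free_group r)" and kw: "replicate k s @ w \<in> carrier (free_group r)"
    using Suc.prems by (auto simp: carrier_free_group reduced_def successively_append_iff)
      (auto simp: reduced_def successively_append_iff successively_Cons)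
  show ?case
    using Suc kw w assms(1,3) rep_Cons[of \<rho> r s "replicate k s @ w"]
    by (simp add: rep_space_closed PSL3.m_assoc[symmetric] PSL3.nat_pow_Suc2[symmetric])
qed

lemma letter_0_1: "2 \<le> r \<Longrightarrow> (0, True) \<in> letters r \<and> (1, True) \<in> letters r"
  by (auto simp: letters_def)

text \<open>Positive words are reduced.\<close>
lemma rep_inj_powers_not_commute:
  fixes k l :: nat
  assumes "\<rho> \<in> rep_space r" "inj_on \<rho> (carrier (free_group r))" "2 \<le> r" "k > 0" "l > 0"
  defines "x \<equiv> \<rho> [(0, True)]" and "y \<equiv> \<rho> [(1, True)]"
  shows "x [^]\<^bsub>PSL3\<^esub> k \<otimes>\<^bsub>PSL3\<^esub> y [^]\<^bsub>PSL3\<^esub> l \<noteq> y [^]\<^bsub>PSL3\<^esub> l \<otimes>\<^bsub>PSL3\<^esub> x [^]\<^bsub>PSL3\<^esub> k"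
proof
  let ?a = "(0::nat, True)" and ?b = "(1::nat, True)"
  assume eq: "x [^]\<^bsub>PSL3\<^esub> k \<otimes>\<^bsub>PSL3\<^esub> y [^]\<^bsub>PSL3\<^esub> l = y [^]\<^bsub>PSL3\<^esub> l \<otimes>\<^bsub>PSL3\<^esub> x [^]\<^bsub>PSL3\<^esub> k"
  have ab: "?a \<in> letters r" "?b \<in> letters r" using letter_0_1 assms(3) by auto
  have pos: "reduced w" if "\<forall>s\<in>set w. snd s" for w
    using that by (induction w rule: induct_list012) (auto simp: letter_inv_def reduced_def)
  have mem: "w \<in> carrier (free_group r)" if "set w \<subseteq> {?a, ?b}" for w
    using that ab by (auto simp: carrier_free_group intro!: pos)
  have pw: "\<rho> (replicate n s) = \<rho> [s] [^]\<^bsub>PSL3\<^esub> n" if "s \<in> {?a, ?b}" for n s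
  proof -
    have "s \<in> letters r" "replicate n s \<in> carrier (free_group r)"
      using that ab by (auto intro!: mem)
    then show ?thesis
      using rep_replicate_append[of \<rho> r n s "[]"] assms(1) by (simp add: rep_Nil rep_space_closed)
  qed
  have two: "\<rho> (replicate m s @ replicate n u) = \<rho> [s] [^]\<^bsub>PSL3\<^esub> m \<otimes>\<^bsub>PSL3\<^esub> \<rho> [u] [^]\<^bsub>PSL3\<^esub> n"
    if "s \<in> {?a, ?b}" "u \<in> {?a, ?b}" for m n s u
  proof -
    have "s \<in> letters r" "replicate m s @ replicate n u \<in> carrier (free_group r)"
      using that ab by (auto intro!: mem)
    then show ?thesis
      using rep_replicate_append[OF assms(1)] pw[OF that(2)] by simp
  qed
  have "\<rho> (replicate k ?a @ replicate l ?b) = x [^]\<^bsub>PSL3\<^esub> k \<otimes>\<^bsub>PSL3\<^esub> y [^]\<^bsub>PSL3\<^esub> l"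
    "\<rho> (replicate l ?b @ replicate k ?a) = y [^]\<^bsub>PSL3\<^esub> l \<otimes>\<^bsub>PSL3\<^esub> x [^]\<^bsub>PSL3\<^esub> k"
    unfolding x_def y_def by (rule two; blast)+
  then have "\<rho> (replicate k ?a @ replicate l ?b) = \<rho> (replicate l ?b @ replicate k ?a)"
    using eq by simp
  then have "replicate k ?a @ replicate l ?b = replicate l ?b @ replicate k ?a"
    by (rule inj_onD[OF assms(2)]; intro mem) auto
  \<comment> \<open>Both exponents are positive, so the two words already differ in their first
    letter.\<close>
  then show False
    using assms(4,5) by (cases k; cases l) auto
qed

lemma rep_letter_mem_image: "s \<in> letters r \<Longrightarrow> \<rho> [s] \<in> rep_image r \<rho>"
  by (auto simp: rep_image_def)

lemma rep_image_not_abelian: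
  assumes "\<rho> \<in> rep_space r" "inj_on \<rho> (carrier (free_group r))" "2 \<le> r"
  shows "\<exists>x\<in>rep_image r \<rho>. \<exists>y\<in>rep_image r \<rho>. x \<otimes>\<^bsub>PSL3\<^esub> y \<noteq> y \<otimes>\<^bsub>PSL3\<^esub> x"
proof -
  have ab: "(0, True) \<in> letters r" "(1, True) \<in> letters r" using letter_0_1[OF assms(3)] by auto
  then have "\<rho> [(0, True)] \<in> carrier PSL3" "\<rho> [(1, True)] \<in> carrier PSL3"
    using assms(1) by (auto intro!: rep_space_closed)
  then have "\<rho> [(0, True)] \<otimes>\<^bsub>PSL3\<^esub> \<rho> [(1, True)] \<noteq> \<rho> [(1, True)] \<otimes>\<^bsub>PSL3\<^esub> \<rho> [(0, True)]"
    using rep_inj_powers_not_commute[OF assms, of 1 1] by simp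
  with ab show ?thesis by (blast intro: rep_letter_mem_image)
qed

lemma nat_pow_sub_psl: "x [^]\<^bsub>sub_psl G\<^esub> (n::nat) = x [^]\<^bsub>PSL3\<^esub> n"
  by (simp add: sub_psl_def nat_pow_def)

lemma (in group) int_pow_commute:
  "g \<in> carrier G \<Longrightarrow> g [^] (p::int) \<otimes> g [^] (q::int) = g [^] q \<otimes> g [^] p"
  by (simp add: int_pow_mult[symmetric] add.commute)

text \<open>Powers of one element commute, whereas no positive powers of the images of two free
  generators do.\<close>

lemma rep_image_not_virtually_cyclic:
  assumes "\<rho> \<in> rep_space r" "inj_on \<rho> (carrier (free_group r))" "2 \<le> r"
    "subgroup (rep_image r \<rho>) PSL3"
  shows "\<not> virtually_cyclic (sub_psl (rep_image r \<rho>))"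
proof
  interpret H: group "sub_psl (rep_image r \<rho>)"
    by (rule group_sub_psl[OF assms(4)])
  let ?x = "\<rho> [(0, True)]" and ?y = "\<rho> [(1, True)]"
  assume "virtually_cyclic (sub_psl (rep_image r \<rho>))"
  then obtain g k l p q where *: "g \<in> rep_image r \<rho>" "k > (0::nat)" "l > (0::nat)"
    "?x [^]\<^bsub>PSL3\<^esub> k = g [^]\<^bsub>sub_psl (rep_image r \<rho>)\<^esub> (p::int)"
    "?y [^]\<^bsub>PSL3\<^esub> l = g [^]\<^bsub>sub_psl (rep_image r \<rho>)\<^esub> (q::int)"
    using H.virtually_cyclic_powers[of ?x ?y] letter_0_1[OF assms(3)]
    by (metis nat_pow_sub_psl rep_letter_mem_image sub_psl_simps(1))
  show False
    using rep_inj_powers_not_commute[OF assms(1-3) *(2,3)] H.int_pow_commute[of g p q] *(1,4,5)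
    by simp
qed

text \<open>Epimorphisms carry commutation to the image, so a single index j at which
  \<open>h j\<close> is an epimorphism is contradictory. No rank is mentioned, which lets the
  approximating groups have ranks that vary with j.\<close>

lemma not_converges_strongly_if_abelian:
  assumes "\<And>x y. x \<in> G \<Longrightarrow> y \<in> G \<Longrightarrow> x \<otimes>\<^bsub>PSL3\<^esub> y = y \<otimes>\<^bsub>PSL3\<^esub> x"
    and "\<And>j. \<exists>x\<in>Gs j. \<exists>y\<in>Gs j. x \<otimes>\<^bsub>PSL3\<^esub> y \<noteq> y \<otimes>\<^bsub>PSL3\<^esub> x"
  shows "\<not> converges_strongly Gs G"
proof
  assume "converges_strongly Gs G"
  then obtain h where "\<forall>\<^sub>F j in sequentially. h j \<in> epi (sub_psl G) (sub_psl (Gs j))"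
    by (auto simp: converges_strongly_def)
  then obtain j where j: "h j \<in> epi (sub_psl G) (sub_psl (Gs j))"
    by (auto simp: eventually_sequentially)
  obtain x y where xy: "x \<in> Gs j" "y \<in> Gs j" "x \<otimes>\<^bsub>PSL3\<^esub> y \<noteq> y \<otimes>\<^bsub>PSL3\<^esub> x"
    using assms(2) by blast
  have im: "h j ` G = Gs j"
    and hm: "\<And>x y. x \<in> G \<Longrightarrow> y \<in> G \<Longrightarrow> h j (x \<otimes>\<^bsub>PSL3\<^esub> y) = h j x \<otimes>\<^bsub>PSL3\<^esub> h j y"
    using j by (auto simp: epi_def hom_def)
  obtain x' y' where xy': "x' \<in> G" "x = h j x'" "y' \<in> G" "y = h j y'"
    using xy(1,2) unfolding im[symmetric] by (elim imageE)
  show False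
    using xy(3) hm[of x' y'] hm[of y' x'] assms(1)[of x' y'] xy' by simp
qed

section \<open>The universal property of the free group\<close>

definition word_value :: "(nat \<Rightarrow> psl) \<Rightarrow> letter list \<Rightarrow> psl" where
  "word_value a w = foldr (\<lambda>s x. (if snd s then a (fst s) else inv\<^bsub>PSL3\<^esub> (a (fst s))) \<otimes>\<^bsub>PSL3\<^esub> x) w \<one>\<^bsub>PSL3\<^esub>"

text \<open>The density argument produces a tuple of group elements; this turns it back into a
  representation. Words are evaluated letter by letter, and cancellation does not change the
  value.\<close>

lemma exists_rep_with_gen_values:
  assumes a: "a \<in> {..<r} \<rightarrow>\<^sub>E carrier PSL3"
  obtains \<rho> where "\<rho> \<in> rep_space r" "gen_values r \<rho> = a"
proof -
  let ?l = "\<lambda>s. if snd s then a (fst s) else inv\<^bsub>PSL3\<^esub> (a (fst s))"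
  have l: "?l s \<in> carrier PSL3" if "s \<in> letters r" for s
    using that a by (auto simp: letters_def)
  have linv: "?l s \<otimes>\<^bsub>PSL3\<^esub> ?l (letter_inv s) = \<one>\<^bsub>PSL3\<^esub>" if "s \<in> letters r" for s
  proof -
    have "a (fst s) \<in> carrier PSL3" using that a by (auto simp: letters_def)
    then show ?thesis by (cases "snd s") (auto simp: letter_inv_def)
  qed
  have wv_Nil: "word_value a [] = \<one>\<^bsub>PSL3\<^esub>"
    and wv_Cons: "word_value a (s # w) = ?l s \<otimes>\<^bsub>PSL3\<^esub> word_value a w" for s w
    by (auto simp: word_value_def)
  have cl: "word_value a w \<in> carrier PSL3" if "set w \<subseteq> letters r" for w
    using that by (induction w) (simp_all add: wv_Nil wv_Cons l del: if_split)
  \<comment> \<open>A cancelled pair of letters contributes the identity, so prepending with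
    reduction multiplies the value in either case.\<close>
  have rc: "word_value a (red_cons s w) = ?l s \<otimes>\<^bsub>PSL3\<^esub> word_value a w"
    if "s \<in> letters r" "set w \<subseteq> letters r" for s w
  proof (cases "w \<noteq> [] \<and> hd w = letter_inv s")
    case True
    then obtain w' where w': "w = letter_inv s # w'" by (cases w) auto
    have "?l s \<otimes>\<^bsub>PSL3\<^esub> word_value a w = (?l s \<otimes>\<^bsub>PSL3\<^esub> ?l (letter_inv s)) \<otimes>\<^bsub>PSL3\<^esub> word_value a w'"
      using that w' l[of s] l[of "letter_inv s"] cl[of w'] unfolding w' wv_Cons
      by (subst PSL3.m_assoc) simp_all
    also have "\<dots> = word_value a w'"
      using that w' cl[of w'] unfolding linv[OF that(1)] by simp
    finally show ?thesis using w' by (simp add: red_cons_def)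
  next
    case False
    then have "red_cons s w = s # w" by (simp only: red_cons_def if_False)
    then show ?thesis by (simp only: wv_Cons)
  qed
  \<comment> \<open>The left factor \<open>v\<close> may be unreduced; only its letters matter for
    the induction.\<close>
  have mult: "word_value a (foldr red_cons v w) = word_value a v \<otimes>\<^bsub>PSL3\<^esub> word_value a w"
    if "set v \<subseteq> letters r" "w \<in> carrier (free_group r)" for v w
    using that(1)
  proof (induction v)
    case Nil
    then show ?case using that cl[of w] by (simp add: word_value_def carrier_free_group)
  next
    case (Cons s v)
    have "foldr red_cons v w \<in> carrier (free_group r)"
      using Cons that by (intro foldr_red_cons_closed) auto
    then have "set (foldr red_cons v w) \<subseteq> letters r" by (simp add: carrier_free_group)
    then have "word_value a (foldr red_cons (s # v) w) =
        ?l s \<otimes>\<^bsub>PSL3\<^esub> (word_value a v \<otimes>\<^bsub>PSL3\<^esub> word_value a w)"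
      using Cons by (simp only: foldr.simps o_apply rc list.set insert_subset)
    also have "\<dots> = word_value a (s # v) \<otimes>\<^bsub>PSL3\<^esub> word_value a w"
      using Cons.prems that l[of s] cl[of v] cl[of w] 
      by (simp only: wv_Cons PSL3.m_assoc list.set insert_subset carrier_free_group)
    finally show ?case .
  qed
  define \<rho> where "\<rho> = restrict (word_value a) (carrier (free_group r))"
  have "\<rho> \<in> rep_space r"
    unfolding rep_space_def hom_def
    using mult cl foldr_red_cons_closed
    by (auto simp: \<rho>_def carrier_free_group free_group_mult Pi_def)
  moreover have "gen_values r \<rho> = a"
  proof
    fix i show "gen_values r \<rho> i = a i"
    proof (cases "i < r")
      case True
      then have "a i \<in> carrier PSL3" using a by auto
      then show ?thesis using True
        by (simp add: gen_values_def \<rho>_def gen_def letters_def word_value_def)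
    next
      case False
      then show ?thesis using a by (auto simp: gen_values_def)
    qed
  qed
  ultimately show thesis using that by blast
qed

section \<open>The lattice of diagonal elements\<close>

lemma diag3_nth:
  "diag3 x y z $ 1 $ 1 = x" "diag3 x y z $ 1 $ 2 = 0" "diag3 x y z $ 1 $ 3 = 0"
  "diag3 x y z $ 2 $ 1 = 0" "diag3 x y z $ 2 $ 2 = y" "diag3 x y z $ 2 $ 3 = 0"
  "diag3 x y z $ 3 $ 1 = 0" "diag3 x y z $ 3 $ 2 = 0" "diag3 x y z $ 3 $ 3 = z"
  by (simp_all add: diag3_def vector_3)

lemma det_diag3: "det (diag3 x y z) = x * y * z"
  by (simp add: det_3 diag3_nth)

lemma diag3_mult: "diag3 x y z ** diag3 x' y' z' = diag3 (x * x') (y * y') (z * z')"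
  by (simp add: vec_eq_iff forall_3 matrix_matrix_mult_def sum_3 diag3_nth)

lemma diag3_mult_vec:
  "(diag3 x y z *v v) $ 1 = x * v $ 1" "(diag3 x y z *v v) $ 2 = y * v $ 2" "(diag3 x y z *v v) $ 3 = z * v $ 3"
  by (simp_all add: matrix_vector_mult_def sum_3 diag3_nth)

lemma diag3_one: "diag3 1 1 1 = mat 1"
  by (simp add: vec_eq_iff forall_3 diag3_nth mat_def)

text \<open>Lifts differ by a cube root of unity, which has modulus 1.\<close>

lemma psl_class_eq_norm:
  assumes "psl_class A = psl_class B"
  shows "norm (A $ i $ j) = norm (B $ i $ j)"
proof -
  have "A \<in> psl_class B" using psl_class_self[of A] assms by simp
  then obtain c where "c ^ 3 = 1" "A = mat c ** B" by (auto simp: psl_class_eq)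
  then show ?thesis by (simp add: mat_mult_nth norm_mult norm_cube_root_of_unity)
qed

text \<open>A lift of the product of the m-th power of the first generator and the n-th power of the
  second.\<close>

definition lattice_mat :: "real \<Rightarrow> int \<Rightarrow> int \<Rightarrow> mat3" where
  "lattice_mat t m n = diag3 (of_real (exp (t * m))) (of_real (exp (t * (n - m)))) (of_real (exp (- t * n)))"

definition lattice_elt :: "real \<Rightarrow> int \<times> int \<Rightarrow> psl" where
  "lattice_elt t = (\<lambda>(m, n). psl_class (lattice_mat t m n))"

lemma det_lattice_mat: "det (lattice_mat t m n) = 1"
  by (simp add: lattice_mat_def det_diag3 algebra_simps flip: of_real_mult exp_add)

lemma lattice_mat_mult: "lattice_mat t m n ** lattice_mat t m' n' = lattice_mat t (m + m') (n + n')"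
  by (simp add: lattice_mat_def diag3_mult algebra_simps flip: of_real_mult exp_add)

lemma lattice_elt_mult:
  "lattice_elt t (m, n) \<otimes>\<^bsub>PSL3\<^esub> lattice_elt t (m', n') = lattice_elt t (m + m', n + n')"
  by (simp add: lattice_elt_def psl_class_mult det_lattice_mat lattice_mat_mult)

lemma lattice_elt_0: "lattice_elt t (0, 0) = \<one>\<^bsub>PSL3\<^esub>"
  by (simp add: lattice_elt_def lattice_mat_def diag3_one psl_class_one)

lemma lattice_elt_closed: "lattice_elt t p \<in> carrier PSL3"
  by (cases p) (auto simp: lattice_elt_def intro!: psl_class_in_PSL3 det_lattice_mat)

lemma lattice_elt_inv: "inv\<^bsub>PSL3\<^esub> (lattice_elt t (m, n)) = lattice_elt t (- m, - n)"
  by (rule PSL3.inv_equality) (simp_all add: lattice_elt_mult lattice_elt_0 lattice_elt_closed)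

text \<open>Each of these two entries depends on one exponent alone, so their moduli recover m and n
  separately. Injectivity and discreteness both rest on this.\<close>

lemma norm_lattice_mat:
  "norm (lattice_mat t m n $ 1 $ 1) = exp (t * m)" "norm (lattice_mat t m n $ 3 $ 3) = exp (- t * n)"
  by (simp_all add: lattice_mat_def diag3_nth)

lemma inj_lattice_elt: "t > 0 \<Longrightarrow> inj (lattice_elt t)"
proof (rule injI)
  fix p q assume t: "t > 0" and eq: "lattice_elt t p = lattice_elt t q"
  obtain m n m' n' where pq: "p = (m, n)" "q = (m', n')" by (cases p, cases q)
  have "psl_class (lattice_mat t m n) = psl_class (lattice_mat t m' n')"
    using eq by (simp add: lattice_elt_def pq)
  note norms = psl_class_eq_norm[OF this]
  show "p = q"
    using norms[of 1 1] norms[of 3 3] t by (simp add: norm_lattice_mat pq)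
qed

lemma range_lattice_eltE:
  assumes "x \<in> range (lattice_elt t)"
  obtains m n where "x = lattice_elt t (m, n)"
  using assms by (metis rangeE surj_pair)

lemma subgroup_range_lattice_elt: "subgroup (range (lattice_elt t)) PSL3"
proof (rule PSL3.subgroupI)
  show "range (lattice_elt t) \<subseteq> carrier PSL3" by (auto simp: lattice_elt_closed)
  show "inv\<^bsub>PSL3\<^esub> x \<in> range (lattice_elt t)" if "x \<in> range (lattice_elt t)" for x
    using that by (elim range_lattice_eltE) (simp add: lattice_elt_inv)
  show "x \<otimes>\<^bsub>PSL3\<^esub> y \<in> range (lattice_elt t)"
    if "x \<in> range (lattice_elt t)" "y \<in> range (lattice_elt t)" for x y
    using that by (elim range_lattice_eltE) (simp add: lattice_elt_mult)
qed auto

lemma lattice_elt_commute: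
  "x \<in> range (lattice_elt t) \<Longrightarrow> y \<in> range (lattice_elt t) \<Longrightarrow> x \<otimes>\<^bsub>PSL3\<^esub> y = y \<otimes>\<^bsub>PSL3\<^esub> x"
  by (auto simp: lattice_elt_mult add.commute)

lemma range_lattice_elt_iso:
  assumes "t > 0"
  shows "sub_psl (range (lattice_elt t)) \<cong> integer_group \<times>\<times> integer_group"
proof -
  have "lattice_elt t \<in> iso (integer_group \<times>\<times> integer_group) (sub_psl (range (lattice_elt t)))"
    using inj_lattice_elt[OF assms]
    by (auto simp: iso_def hom_def bij_betw_def lattice_elt_mult DirProd_def)
  then have "integer_group \<times>\<times> integer_group \<cong> sub_psl (range (lattice_elt t))"
    by (auto simp: is_iso_def)
  moreover have "group (integer_group \<times>\<times> integer_group)" by (simp add: DirProd_group)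
  ultimately show ?thesis using group.iso_sym by blast
qed

lemma rep_image_mult_closed:
  assumes "\<rho> \<in> rep_space r" "x \<in> rep_image r \<rho>" "y \<in> rep_image r \<rho>"
  shows "x \<otimes>\<^bsub>PSL3\<^esub> y \<in> rep_image r \<rho>"
proof -
  obtain v w where vw: "v \<in> carrier (free_group r)" "w \<in> carrier (free_group r)" "x = \<rho> v" "y = \<rho> w"
    using assms(2,3) by (auto simp: rep_image_def)
  then have "x \<otimes>\<^bsub>PSL3\<^esub> y = \<rho> (foldr red_cons v w)"
    using assms(1) by (auto simp: rep_space_def hom_def free_group_mult)
  moreover have "foldr red_cons v w \<in> carrier (free_group r)"
    using vw by (auto simp: carrier_free_group intro!: foldr_red_cons_closed[unfolded carrier_free_group])
  ultimately show ?thesis by (simp add: rep_image_def)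
qed

lemma rep_image_eq_range_lattice_elt:
  assumes \<rho>: "\<rho> \<in> rep_space 2"
    "\<rho> (gen 0) = psl_class (diag3 (of_real (exp t)) (of_real (exp (- t))) 1)"
    "\<rho> (gen 1) = psl_class (diag3 1 (of_real (exp t)) (of_real (exp (- t))))"
  shows "rep_image 2 \<rho> = range (lattice_elt t)"
proof
  have g: "\<rho> [(0, True)] = lattice_elt t (1, 0)" "\<rho> [(1, True)] = lattice_elt t (0, 1)"
    using \<rho>(2,3) by (auto simp: gen_def lattice_elt_def lattice_mat_def)
  have lts: "(0, b) \<in> letters 2" "(1, b) \<in> letters 2" for b by (auto simp: letters_def)
  have g': "\<rho> [(0, False)] = lattice_elt t (-1, 0)" "\<rho> [(1, False)] = lattice_elt t (0, -1)"
    using rep_letter_inv[OF \<rho>(1) lts(1)[of True]] rep_letter_inv[OF \<rho>(1) lts(2)[of True]]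
    unfolding g lattice_elt_inv by (simp_all add: letter_inv_def)
  have gs: "\<rho> [s] \<in> range (lattice_elt t)" if "s \<in> letters 2" for s
  proof -
    have "s \<in> {(0, True), (0, False), (1, True), (1, False)}"
      using that by (cases s) (auto simp: letters_def)
    then show ?thesis using g g' by auto
  qed
  show "rep_image 2 \<rho> \<subseteq> range (lattice_elt t)"
  proof -
    have "\<rho> w \<in> range (lattice_elt t)" if "w \<in> carrier (free_group 2)" for w
      using that
    proof (induction w)
      case Nil
      then show ?case using rep_Nil[OF \<rho>(1)] lattice_elt_0[of t] by (metis rangeI)
    next
      case (Cons s w)
      have "s \<in> letters 2" "w \<in> carrier (free_group 2)"
        using Cons.prems by (auto simp: carrier_free_group reduced_Cons)
      then show ?case
        using Cons.IH gs rep_Cons[OF \<rho>(1) Cons.prems] subgroup.m_closed[OF subgroup_range_lattice_elt] by simp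
    qed
    then show ?thesis by (auto simp: rep_image_def)
  qed
  have mem: "lattice_elt t (1, 0) \<in> rep_image 2 \<rho>" "lattice_elt t (0, 1) \<in> rep_image 2 \<rho>"
    "lattice_elt t (-1, 0) \<in> rep_image 2 \<rho>" "lattice_elt t (0, -1) \<in> rep_image 2 \<rho>"
    using rep_letter_mem_image[of _ 2 \<rho>] lts by (metis g g')+
  have 0: "lattice_elt t (0, 0) \<in> rep_image 2 \<rho>"
    unfolding lattice_elt_0 rep_image_def using rep_Nil[OF \<rho>(1)] by (intro image_eqI[of _ _ "[]"]) auto
  \<comment> \<open>Integer induction leaves 0 in both directions, hence the inverse generators in
    \<open>mem\<close>. The row n = 0 comes first and is the base for the columns.\<close>
  have m: "lattice_elt t (m, 0) \<in> rep_image 2 \<rho>" for m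
  proof (induction m rule: int_induct[where k = 0])
    case (step1 i)
    then show ?case using rep_image_mult_closed[OF \<rho>(1) _ mem(1)] by (fastforce simp: lattice_elt_mult)
  next
    case (step2 i)
    then show ?case using rep_image_mult_closed[OF \<rho>(1) _ mem(3)] by (fastforce simp: lattice_elt_mult)
  qed (rule 0)
  have "lattice_elt t (m, n) \<in> rep_image 2 \<rho>" for m n
  proof (induction n rule: int_induct[where k = 0])
    case (step1 i)
    then show ?case using rep_image_mult_closed[OF \<rho>(1) _ mem(2)] by (fastforce simp: lattice_elt_mult)
  next
    case (step2 i)
    then show ?case using rep_image_mult_closed[OF \<rho>(1) _ mem(4)] by (fastforce simp: lattice_elt_mult)
  qed (rule m)
  then show "range (lattice_elt t) \<subseteq> rep_image 2 \<rho>" by auto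
qed

lemma lattice_elt_nat_pow: "lattice_elt t (m, n) [^]\<^bsub>PSL3\<^esub> (k::nat) = lattice_elt t (int k * m, int k * n)"
  by (induction k) (simp_all add: lattice_elt_0 lattice_elt_mult algebra_simps)

text \<open>Virtual cyclicity refers to powers in the subgroup. Natural powers do not see the
  carrier, but the inverse does, so it is computed anew for negative exponents.\<close>

lemma lattice_elt_int_pow:
  "lattice_elt t (m, n) [^]\<^bsub>sub_psl (range (lattice_elt t))\<^esub> (k::int) = lattice_elt t (k * m, k * n)"
proof -
  interpret H: group "sub_psl (range (lattice_elt t))"
    by (rule group_sub_psl[OF subgroup_range_lattice_elt])
  show ?thesis
  proof (cases k rule: int_cases2)
    case (nonneg i)
    then show ?thesis by (simp add: int_pow_int nat_pow_sub_psl lattice_elt_nat_pow)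
  next
    case (nonpos i)
    have "inv\<^bsub>sub_psl (range (lattice_elt t))\<^esub> (lattice_elt t (i * m, i * n)) = lattice_elt t (- i * m, - i * n)"
      by (rule H.inv_equality) (simp_all add: lattice_elt_mult lattice_elt_0)
    then show ?thesis
      using nonpos by (simp add: H.int_pow_neg int_pow_int nat_pow_sub_psl lattice_elt_nat_pow)
  qed
qed

lemma range_lattice_elt_not_virtually_cyclic:
  assumes "t > 0"
  shows "\<not> virtually_cyclic (sub_psl (range (lattice_elt t)))"
proof
  let ?G = "sub_psl (range (lattice_elt t))"
  interpret H: group ?G
    by (rule group_sub_psl[OF subgroup_range_lattice_elt])
  assume "virtually_cyclic ?G"
  then obtain g and k l :: nat and p q :: int where g: "g \<in> carrier ?G" "k > 0" "l > 0"
    "lattice_elt t (1, 0) [^]\<^bsub>?G\<^esub> k = g [^]\<^bsub>?G\<^esub> p" "lattice_elt t (0, 1) [^]\<^bsub>?G\<^esub> l = g [^]\<^bsub>?G\<^esub> q"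
    by (rule H.virtually_cyclic_powers[where x = "lattice_elt t (1, 0)" and y = "lattice_elt t (0, 1)"]) auto
  obtain m n where mn: "g = lattice_elt t (m, n)" using g(1) unfolding sub_psl_simps by (rule range_lattice_eltE)
  have "lattice_elt t (int k, 0) = lattice_elt t (p * m, p * n)"
    "lattice_elt t (0, int l) = lattice_elt t (q * m, q * n)"
    using g(4,5) by (simp_all add: mn lattice_elt_int_pow nat_pow_sub_psl lattice_elt_nat_pow)
  then have "int k = p * m" "0 = p * n" "0 = q * m" "int l = q * n"
    by (simp_all add: inj_eq[OF inj_lattice_elt[OF assms]])
  \<comment> \<open>From \<open>int k = p * m\<close> with k positive, p is nonzero; then n = 0,
    which contradicts \<open>int l = q * n\<close>.\<close>
  with g(2,3) show False by (metis mult_eq_0_iff of_nat_0_less_iff less_irrefl)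
qed

lemma discrete_range_lattice_elt:
  assumes "t > 0"
  shows "discrete_subgroup (range (lattice_elt t))"
  unfolding discrete_subgroup_def
proof
  let ?G = "range (lattice_elt t)"
  have "openin (subtopology PSL3_top ?G) {x}" if xG: "x \<in> ?G" for x
  proof -
    obtain m n where x: "x = lattice_elt t (m, n)" using xG by (rule range_lattice_eltE)
    \<comment> \<open>Open windows reaching one step to either side of m and n; being strict, they
      contain no other integer point. The factor \<open>- t\<close> reverses the order, which swaps
      the ends of the window for n.\<close>
    define S where "S = {A :: mat3. norm (A $ 1 $ 1) \<in> {exp (t * (m - 1)) <..< exp (t * (m + 1))} \<and>
        norm (A $ 3 $ 3) \<in> {exp (- t * (n + 1)) <..< exp (- t * (n - 1))}}"
    define W where "W = psl_class ` (S \<inter> carrier SL3)"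
    have "open S"
      unfolding S_def greaterThanLessThan_iff by (intro open_Collect_conj open_Collect_less continuous_intros)
    \<comment> \<open>\<open>S\<close> restricts moduli only, so it contains all lifts of a class or
      none; hence its image \<open>W\<close> is open in the quotient.\<close>
    have inv: "psl_class A \<in> W \<longleftrightarrow> A \<in> S" if "det A = 1" for A
    proof
      assume "psl_class A \<in> W"
      then obtain B where "B \<in> S" "psl_class A = psl_class B" by (auto simp: W_def)
      then show "A \<in> S" using psl_class_eq_norm[of A B] by (simp add: S_def)
    qed (use that in \<open>auto simp: W_def\<close>)
    have "{A \<in> carrier SL3. psl_class A \<in> W} = carrier SL3 \<inter> S" using inv by auto
    then have "openin PSL3_top W"
      using \<open>open S\<close> by (auto simp: openin_PSL3_top W_def psl_class_in_PSL3 openin_open)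
    moreover have "W \<inter> ?G = {x}"
    proof -
      have "lattice_mat t m' n' \<in> S \<longleftrightarrow> m' = m \<and> n' = n" for m' n'
      proof -
        have "t * real_of_int (m - 1) < t * real_of_int m' \<longleftrightarrow> m - 1 < m'"
          "t * real_of_int m' < t * real_of_int (m + 1) \<longleftrightarrow> m' < m + 1"
          "- t * real_of_int (n + 1) < - t * real_of_int n' \<longleftrightarrow> n' < n + 1"
          "- t * real_of_int n' < - t * real_of_int (n - 1) \<longleftrightarrow> n - 1 < n'"
          using assms by (simp_all only: mult_less_cancel_left_pos mult_minus_left neg_less_iff_less of_int_less_iff)
        then show ?thesis
          unfolding S_def mem_Collect_eq greaterThanLessThan_iff norm_lattice_mat exp_less_cancel_iff by linarith
      qed
      then have "lattice_elt t (m', n') \<in> W \<longleftrightarrow> m' = m \<and> n' = n" for m' n'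
        using inv[OF det_lattice_mat] by (simp add: lattice_elt_def)
      then show ?thesis by (auto simp: x)
    qed
    ultimately show ?thesis by (auto simp: openin_subtopology intro!: exI[of _ W])
  qed
  moreover have "topspace (subtopology PSL3_top ?G) = ?G"
    by (auto simp: topspace_subtopology topspace_PSL3_top lattice_elt_closed)
  ultimately show "subtopology PSL3_top ?G = discrete_topology ?G"
    using discrete_topology_unique by metis
qed (rule subgroup_range_lattice_elt)

section \<open>The Kulkarni limit set of the diagonal lattice\<close>

lemma proj_point_eq: "proj_point v = range (\<lambda>k. k *s v)"
  by (simp add: proj_point_def vec.span_singleton)

lemma act_psl_class_proj_point: "act (psl_class D) (proj_point v) = proj_point (D *v v)"
proof
  have *: "(mat c ** D) *v (k *s v) = (c * k) *s (D *v v)" for c k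
    by (simp add: vec_eq_iff matrix_vector_mult_def mat_mult_nth sum_distrib_left mult_ac)
  show "act (psl_class D) (proj_point v) \<subseteq> proj_point (D *v v)"
    using * by (auto simp: act_def psl_class_eq proj_point_eq)
  show "proj_point (D *v v) \<subseteq> act (psl_class D) (proj_point v)"
  proof
    fix x assume "x \<in> proj_point (D *v v)"
    then obtain k where "x = k *s (D *v v)" by (auto simp: proj_point_eq)
    then have "x = D *v (k *s v)" by (simp add: vec_eq_iff matrix_vector_mult_def sum_distrib_left mult_ac)
    then show "x \<in> act (psl_class D) (proj_point v)"
      using psl_class_self[of D] by (auto simp: act_def proj_point_eq)
  qed
qed

lemma proj_point_scale: "c \<noteq> 0 \<Longrightarrow> proj_point (c *s v) = proj_point v"
proof
  assume c: "c \<noteq> 0"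
  show "proj_point (c *s v) \<subseteq> proj_point v" by (auto simp: proj_point_eq)
  have "k *s v = (k / c) *s (c *s v)" for k using c by simp
  then show "proj_point v \<subseteq> proj_point (c *s v)" unfolding proj_point_eq by (metis (no_types, lifting) image_subsetI rangeI)
qed

lemma proj_point_eqD: "proj_point v = proj_point w \<Longrightarrow> \<exists>c. v = c *s w"
proof -
  assume "proj_point v = proj_point w"
  moreover have "v \<in> proj_point v" by (auto simp: proj_point_eq intro!: range_eqI[of _ _ 1])
  ultimately show ?thesis by (auto simp: proj_point_eq)
qed

lemma topspace_P2_top: "topspace P2_top = P2"
  by (simp add: P2_top_def topspace_quotient_topology P2_def)

lemma openin_P2_top:
  "openin P2_top W \<longleftrightarrow> W \<subseteq> P2 \<and> openin (top_of_set (UNIV - {0})) {v \<in> UNIV - {0}. proj_point v \<in> W}"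
  by (simp add: P2_top_def openin_quotient_topology P2_def)

text \<open>The preimage of a point is a complex line without 0, and complex lines are closed. In a
  T1 space every neighbourhood of an accumulation point contains infinitely many points of the set,
  which is the form of accumulation used for \<open>Kul1\<close>.\<close>

lemma t1_space_P2_top: "t1_space P2_top"
  unfolding t1_space_closedin_singleton
proof
  fix p assume "p \<in> topspace P2_top"
  then obtain w where w: "w \<noteq> 0" "p = proj_point w" by (auto simp: topspace_P2_top P2_def)
  have "v \<in> proj_point w \<longleftrightarrow> proj_point v = p" if "v \<noteq> 0" for v
  proof
    assume "v \<in> proj_point w"
    then obtain c where "v = c *s w" by (auto simp: proj_point_eq)
    with that show "proj_point v = p" using w proj_point_scale[of c w] by auto
  qed (use proj_point_eqD[of v w] w in \<open>auto simp: proj_point_eq\<close>)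
  then have eq: "{v \<in> UNIV - {0}. proj_point v \<in> P2 - {p}} = (UNIV - {0}) \<inter> - proj_point w"
    by (auto simp: P2_def)
  have "closed (proj_point w)"
  proof -
    \<comment> \<open>Closedness is available for real subspaces, so the complex line is regarded as
      one.\<close>
    have "subspace (proj_point w)"
      unfolding proj_point_eq
    proof (rule subspaceI)
      fix x y :: "complex^3" and c :: real
      show "0 \<in> range (\<lambda>k. k *s w)" by (intro range_eqI[of _ _ 0]) simp
      show "x + y \<in> range (\<lambda>k. k *s w)" if "x \<in> range (\<lambda>k. k *s w)" "y \<in> range (\<lambda>k. k *s w)"
      proof -
        obtain k l where "x = k *s w" "y = l *s w" using \<open>x \<in> _\<close> \<open>y \<in> _\<close> by (elim rangeE)
        then have "x + y = (k + l) *s w" by (simp only: vec.scale_left_distrib)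
        then show ?thesis by (rule range_eqI)
      qed
      show "c *\<^sub>R x \<in> range (\<lambda>k. k *s w)" if x: "x \<in> range (\<lambda>k. k *s w)"
      proof -
        obtain k where "x = k *s w" using x by (elim rangeE)
        then have "c *\<^sub>R x = (complex_of_real c * k) *s w" by (simp add: vec_eq_iff) (simp add: scaleR_conv_of_real)
        then show ?thesis by (rule range_eqI)
      qed
    qed
    then show ?thesis by (rule closed_subspace)
  qed
  then have "openin (top_of_set (UNIV - {0})) {v \<in> UNIV - {0}. proj_point v \<in> P2 - {p}}"
    unfolding eq by (intro openin_open_Int open_Compl)
  then have "openin P2_top (P2 - {p})"
    unfolding openin_P2_top by blast
  then show "closedin P2_top {p}"
    using \<open>p \<in> topspace P2_top\<close> by (simp add: closedin_def topspace_P2_top)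
qed

text \<open>Only ratios of moduli enter, so the condition descends to projective points. Strictness
  makes the region open and forces every coordinate to be nonzero; the pairs with i = j force C >
  1.\<close>

definition balanced :: "real \<Rightarrow> complex^3 \<Rightarrow> bool" where
  "balanced C v \<longleftrightarrow> (\<forall>i j. norm (v $ i) < C * norm (v $ j))"

definition balanced_points :: "real \<Rightarrow> pt set" where
  "balanced_points C = proj_point ` {v. balanced C v}"

text \<open>A point lies in some \<open>balanced_points C\<close> iff all its homogeneous coordinates are nonzero.\<close>
definition coordinate_lines :: "pt set" where
  "coordinate_lines = {p \<in> P2. \<forall>C. p \<notin> balanced_points C}"

lemma balanced_nonzero: "balanced C v \<Longrightarrow> v $ i \<noteq> 0"
  unfolding balanced_def by (metis mult_zero_right norm_not_less_zero norm_zero)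

lemma balanced_not_0: "balanced C v \<Longrightarrow> v \<noteq> 0"
  using balanced_nonzero[of C v 1] by auto

lemma balanced_gt_1: "balanced C v \<Longrightarrow> C > 1"
  using balanced_nonzero[of C v 1] by (auto simp: balanced_def dest!: spec[of _ 1])

lemma balanced_mono:
  assumes "balanced C v" "C \<le> C'" shows "balanced C' v"
  unfolding balanced_def
proof (intro allI)
  fix i j
  have "norm (v $ i) < C * norm (v $ j)" using assms(1) by (simp add: balanced_def)
  also have "\<dots> \<le> C' * norm (v $ j)" using assms(2) by (simp add: mult_right_mono)
  finally show "norm (v $ i) < C' * norm (v $ j)" .
qed

lemma balanced_points_mono: "C \<le> C' \<Longrightarrow> balanced_points C \<subseteq> balanced_points C'"
  by (auto simp: balanced_points_def intro: balanced_mono)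

lemma balanced_scale: "c \<noteq> 0 \<Longrightarrow> balanced C (c *s v) \<longleftrightarrow> balanced C v"
  by (simp add: balanced_def norm_mult mult.left_commute)

lemma proj_point_in_balanced_points: "v \<noteq> 0 \<Longrightarrow> proj_point v \<in> balanced_points C \<longleftrightarrow> balanced C v"
proof
  assume v: "v \<noteq> 0" and "proj_point v \<in> balanced_points C"
  then obtain w where w: "balanced C w" "proj_point v = proj_point w" by (auto simp: balanced_points_def)
  then obtain c where c: "v = c *s w" using proj_point_eqD by blast
  then have "c \<noteq> 0" using v by auto
  then show "balanced C v" using w c balanced_scale by simp
qed (auto simp: balanced_points_def)

lemma openin_balanced_points: "openin P2_top (balanced_points C)"
proof -
  have *: "{v \<in> UNIV - {0}. proj_point v \<in> balanced_points C} = {v. balanced C v}"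
    using proj_point_in_balanced_points balanced_not_0 by blast
  have "open {v. balanced C v}"
    unfolding balanced_def Collect_all_eq
    by (intro open_INT finite ballI open_Collect_less continuous_intros)
  moreover have "{v. balanced C v} \<subseteq> UNIV - {0}" using balanced_not_0 by blast
  ultimately have "openin (top_of_set (UNIV - {0})) {v. balanced C v}"
    by (meson open_subset)
  moreover have "balanced_points C \<subseteq> P2"
    using balanced_not_0 unfolding balanced_points_def P2_def by blast
  ultimately show ?thesis unfolding openin_P2_top * by blast
qed

lemma closedin_coordinate_lines: "closedin P2_top coordinate_lines"
proof -
  have "P2 - coordinate_lines = P2 \<inter> (\<Union>C. balanced_points C)" by (auto simp: coordinate_lines_def)
  moreover have "openin P2_top (P2 \<inter> (\<Union>C. balanced_points C))"
    using openin_topspace[of P2_top] unfolding topspace_P2_top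
    by (intro openin_Int openin_Union) (auto simp: openin_balanced_points)
  ultimately show ?thesis
    by (auto simp: closedin_def topspace_P2_top coordinate_lines_def)
qed

lemma coordinate_lines_zero_entry:
  assumes "v \<noteq> 0" "proj_point v \<in> coordinate_lines"
  shows "\<exists>k. v $ k = 0"
proof (rule ccontr)
  assume "\<nexists>k. v $ k = 0"
  then have nz: "v $ k \<noteq> 0" for k by blast
  \<comment> \<open>The sum of all ratios bounds each of them, and the summand 1 makes the bound
    strict.\<close>
  define C where "C = 1 + (\<Sum>i\<in>UNIV. \<Sum>j\<in>UNIV. norm (v $ i) / norm (v $ j))"
  have "norm (v $ i) / norm (v $ j) < C" for i j
  proof -
    have "norm (v $ i) / norm (v $ j) \<le> (\<Sum>j\<in>UNIV. norm (v $ i) / norm (v $ j))"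
      by (rule member_le_sum) auto
    also have "\<dots> \<le> (\<Sum>i\<in>UNIV. \<Sum>j\<in>UNIV. norm (v $ i) / norm (v $ j))"
      by (rule member_le_sum[of i UNIV "\<lambda>i. \<Sum>j\<in>UNIV. norm (v $ i) / norm (v $ j)"]) (auto intro: sum_nonneg)
    finally show ?thesis by (simp add: C_def)
  qed
  then have "balanced C v"
    using nz by (simp add: balanced_def divide_less_eq)
  then show False
    using assms by (auto simp: coordinate_lines_def proj_point_in_balanced_points)
qed

lemma act_lattice_elt: "act (lattice_elt t (m, n)) (proj_point v) = proj_point (lattice_mat t m n *v v)"
  by (simp add: lattice_elt_def act_psl_class_proj_point)

text \<open>This is the estimate behind all three parts of the limit set. If a vector and its image
  are both balanced with constant C, any two diagonal entries of the matrix have ratio below C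
  squared. Their logarithms sum to 0, so each logarithm is bounded, and with it m and n.\<close>

lemma finite_balanced_returns:
  assumes "t > 0"
  shows "finite {g \<in> range (lattice_elt t). act g ` balanced_points C \<inter> balanced_points C \<noteq> {}}"
proof (rule finite_subset)
  \<comment> \<open>Dividing the bound \<open>ln (C ^ 2)\<close> on the exponents
    \<open>t * m\<close> and \<open>- t * n\<close> by t bounds the integers.\<close>
  define K where "K = \<lceil>ln (C ^ 2) / t\<rceil>"
  show "{g \<in> range (lattice_elt t). act g ` balanced_points C \<inter> balanced_points C \<noteq> {}}
      \<subseteq> lattice_elt t ` ({- K..K} \<times> {- K..K})"
  proof
    fix g assume "g \<in> {g \<in> range (lattice_elt t). act g ` balanced_points C \<inter> balanced_points C \<noteq> {}}"
    then obtain m n v where g: "g = lattice_elt t (m, n)" and v: "balanced C v"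
      and "act g (proj_point v) \<in> balanced_points C"
      by (auto simp: balanced_points_def)
    then have in_C: "proj_point (lattice_mat t m n *v v) \<in> balanced_points C"
      by (simp add: act_lattice_elt)
    define a :: "3 \<Rightarrow> real" where "a i = (if i = 1 then t * m else if i = 2 then t * (n - m) else - t * n)" for i
    have nth: "(lattice_mat t m n *v v) $ i = of_real (exp (a i)) * v $ i" for i
      using exhaust_3[of i] by (auto simp: lattice_mat_def diag3_mult_vec a_def)
    have "lattice_mat t m n *v v \<noteq> 0"
      using nth[of 1] balanced_nonzero[OF v, of 1]
      by (metis exp_not_eq_zero mult_eq_0_iff of_real_eq_0_iff zero_index)
    then have bal: "balanced C (lattice_mat t m n *v v)"
      using in_C proj_point_in_balanced_points by blast
    have "C > 1" using balanced_gt_1[OF v] .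
    have diff: "a i - a j < ln (C ^ 2)" for i j
    proof -
      have "exp (a i) * norm (v $ i) < C * (exp (a j) * norm (v $ j))"
        using bal unfolding balanced_def nth by (simp add: norm_mult)
      also have "\<dots> \<le> C * (exp (a j) * (C * norm (v $ i)))"
        using v \<open>C > 1\<close> by (auto simp: balanced_def less_imp_le intro!: mult_left_mono)
      finally have "exp (a i) * norm (v $ i) < (C ^ 2 * exp (a j)) * norm (v $ i)"
        by (simp add: power2_eq_square mult_ac)
      then have "exp (a i) < C ^ 2 * exp (a j)"
        by (rule mult_right_less_imp_less) simp
      also have "\<dots> = exp (ln (C ^ 2) + a j)"
        using \<open>C > 1\<close> by (simp add: exp_add)
      finally show ?thesis by simp
    qed
    have sum: "a 1 + a 2 + a 3 = 0" by (simp add: a_def algebra_simps)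
    have "0 < ln (C ^ 2)" using diff[of 1 1] by simp
    \<comment> \<open>Since the sum is 0, \<open>3 * a 1\<close> equals
      \<open>(a 1 - a 2) + (a 1 - a 3)\<close>, and similarly for \<open>a 3\<close> and with
      reversed signs.\<close>
    then have "\<bar>a 1\<bar> < ln (C ^ 2)" "\<bar>a 3\<bar> < ln (C ^ 2)"
      using sum diff[of 1 2] diff[of 1 3] diff[of 2 1] diff[of 3 1] diff[of 3 2] diff[of 2 3] by linarith+
    then have "t * \<bar>real_of_int m\<bar> < ln (C ^ 2)" "t * \<bar>real_of_int n\<bar> < ln (C ^ 2)"
      using assms by (simp_all add: a_def abs_mult)
    then have "\<bar>real_of_int m\<bar> < ln (C ^ 2) / t" "\<bar>real_of_int n\<bar> < ln (C ^ 2) / t"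
      using assms by (simp_all add: pos_less_divide_eq mult.commute)
    then have "\<bar>m\<bar> \<le> K" "\<bar>n\<bar> \<le> K" unfolding K_def by linarith+
    then show "g \<in> lattice_elt t ` ({- K..K} \<times> {- K..K})"
      unfolding g by (intro imageI) auto
  qed
qed auto

text \<open>If one coordinate of a point vanishes, the lattice elements whose other two diagonal
  entries agree act on the vector as scalars. They form an infinite cyclic group in the
  stabilizer.\<close>

lemma coordinate_lines_subset_Kul0:
  assumes "t > 0"
  shows "coordinate_lines \<subseteq> Kul0 (range (lattice_elt t))"
proof
  fix p assume p: "p \<in> coordinate_lines"
  then obtain v where v: "v \<noteq> 0" "p = proj_point v" by (auto simp: coordinate_lines_def P2_def)
  have infin: "infinite {g \<in> range (lattice_elt t). act g p = p}"
    if f: "inj f" and act: "\<And>j. \<exists>c. c \<noteq> 0 \<and> lattice_mat t (fst (f j)) (snd (f j)) *v v = c *s v"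
    for f :: "int \<Rightarrow> int \<times> int"
  proof -
    have "act (lattice_elt t (f j)) p = p" for j
    proof -
      obtain c where "c \<noteq> 0" "lattice_mat t (fst (f j)) (snd (f j)) *v v = c *s v"
        using act by blast
      then show ?thesis
        using act_lattice_elt[of t "fst (f j)" "snd (f j)" v] proj_point_scale[of c v]
        unfolding prod.collapse v(2) by simp
    qed
    then have "range (\<lambda>j. lattice_elt t (f j)) \<subseteq> {g \<in> range (lattice_elt t). act g p = p}"
      by (intro image_subsetI CollectI conjI rangeI)
    moreover have "infinite (range (\<lambda>j. lattice_elt t (f j)))"
    proof -
      have "inj (\<lambda>j. lattice_elt t (f j))"
        using inj_compose[OF inj_lattice_elt[OF assms] f] by (simp add: o_def)
      then show ?thesis using finite_imageD infinite_UNIV_int by blast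
    qed
    ultimately show ?thesis using finite_subset by blast
  qed
  obtain k where k: "v $ k = 0" using coordinate_lines_zero_entry p v by blast
  consider "k = 1" | "k = 2" | "k = 3" using exhaust_3 by blast
  then have "infinite {g \<in> range (lattice_elt t). act g p = p}"
  proof cases
    case 1
    show ?thesis
    proof (rule infin)
      \<comment> \<open>Second and third entries agree when n - m = -n.\<close>
      show "inj (\<lambda>j::int. (2 * j, j))" by (simp add: inj_def)
      fix j :: int
      have "lattice_mat t (fst (2 * j, j)) (snd (2 * j, j)) *v v = complex_of_real (exp (- t * j)) *s v"
        using k 1 by (simp add: vec_eq_iff forall_3 lattice_mat_def diag3_mult_vec)
      then show "\<exists>c. c \<noteq> 0 \<and> lattice_mat t (fst (2 * j, j)) (snd (2 * j, j)) *v v = c *s v"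
        by (metis exp_not_eq_zero of_real_eq_0_iff)
    qed
  next
    case 2
    show ?thesis
    proof (rule infin)
      \<comment> \<open>First and third entries agree when m = -n.\<close>
      show "inj (\<lambda>j::int. (- j, j))" by (simp add: inj_def)
      fix j :: int
      have "lattice_mat t (fst (- j, j)) (snd (- j, j)) *v v = complex_of_real (exp (- t * j)) *s v"
        using k 2 by (simp add: vec_eq_iff forall_3 lattice_mat_def diag3_mult_vec)
      then show "\<exists>c. c \<noteq> 0 \<and> lattice_mat t (fst (- j, j)) (snd (- j, j)) *v v = c *s v"
        by (metis exp_not_eq_zero of_real_eq_0_iff)
    qed
  next
    case 3
    show ?thesis
    proof (rule infin)
      \<comment> \<open>First and second entries agree when m = n - m.\<close>
      show "inj (\<lambda>j::int. (j, 2 * j))" by (simp add: inj_def)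
      fix j :: int
      have "lattice_mat t (fst (j, 2 * j)) (snd (j, 2 * j)) *v v = complex_of_real (exp (t * j)) *s v"
        using k 3 by (simp add: vec_eq_iff forall_3 lattice_mat_def diag3_mult_vec)
      then show "\<exists>c. c \<noteq> 0 \<and> lattice_mat t (fst (j, 2 * j)) (snd (j, 2 * j)) *v v = c *s v"
        by (metis exp_not_eq_zero of_real_eq_0_iff)
    qed
  qed
  moreover have "p \<in> P2" using p by (simp add: coordinate_lines_def)
  ultimately show "p \<in> Kul0 (range (lattice_elt t))"
    unfolding Kul0_def by (intro subsetD[OF closure_of_subset]) (auto simp: topspace_P2_top)
qed

text \<open>An element that fixes a point of a balanced region returns the region to itself, so
  points off the coordinate lines have finite stabilizers. The closure adds nothing because the
  lines are closed.\<close>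

lemma Kul0_lattice:
  assumes "t > 0"
  shows "Kul0 (range (lattice_elt t)) = coordinate_lines"
proof
  show "Kul0 (range (lattice_elt t)) \<subseteq> coordinate_lines"
    unfolding Kul0_def
  proof (rule closure_of_minimal[OF _ closedin_coordinate_lines], rule subsetI, rule ccontr)
    fix p assume p: "p \<in> {p \<in> P2. infinite {g \<in> range (lattice_elt t). act g p = p}}" "p \<notin> coordinate_lines"
    then obtain C where "p \<in> balanced_points C" by (auto simp: coordinate_lines_def)
    then have "{g \<in> range (lattice_elt t). act g p = p}
        \<subseteq> {g \<in> range (lattice_elt t). act g ` balanced_points C \<inter> balanced_points C \<noteq> {}}"
      by blast
    then show False using p finite_balanced_returns[OF assms] finite_subset by blast
  qed
qed (rule coordinate_lines_subset_Kul0[OF assms])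

text \<open>Off the lines, one balanced region contains both the base point z and the supposed
  accumulation point q. Orbit points of z in that region come from the finitely many returning
  elements, too few to accumulate at q.\<close>

lemma Kul1_lattice:
  assumes "t > 0"
  shows "Kul1 (range (lattice_elt t)) \<subseteq> coordinate_lines"
  unfolding Kul1_def
proof (rule closure_of_minimal[OF _ closedin_coordinate_lines], rule subsetI, rule ccontr)
  let ?G = "range (lattice_elt t)"
  fix q assume q: "q \<in> (\<Union>z\<in>P2 - Kul0 ?G. P2_top derived_set_of ((\<lambda>g. act g z) ` ?G))" "q \<notin> coordinate_lines"
  then obtain z where z: "z \<in> P2" "z \<notin> coordinate_lines" "q \<in> P2_top derived_set_of ((\<lambda>g. act g z) ` ?G)"
    by (auto simp: Kul0_lattice[OF assms])
  then have inf: "infinite ((\<lambda>g. act g z) ` ?G \<inter> U)" if "q \<in> U" "openin P2_top U" for U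
    using t1_space_P2_top that unfolding t1_space_derived_set_of_infinite_openin by auto
  have "q \<in> P2" using z(3) by (auto simp: in_derived_set_of topspace_P2_top)
  then obtain C C' where "q \<in> balanced_points C" "z \<in> balanced_points C'"
    using q(2) z(1,2) by (auto simp: coordinate_lines_def)
  then have qz: "q \<in> balanced_points (max C C')" "z \<in> balanced_points (max C C')"
    using balanced_points_mono[of C "max C C'"] balanced_points_mono[of C' "max C C'"] by auto
  have "(\<lambda>g. act g z) ` ?G \<inter> balanced_points (max C C') \<subseteq>
      (\<lambda>g. act g z) ` {g \<in> ?G. act g ` balanced_points (max C C') \<inter> balanced_points (max C C') \<noteq> {}}"
    using qz(2) by blast
  then have "finite ((\<lambda>g. act g z) ` ?G \<inter> balanced_points (max C C'))"
    using finite_balanced_returns[OF assms] by (meson finite_imageI finite_subset)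
  then show False using inf[OF qz(1) openin_balanced_points] by blast
qed

lemma compact_subset_balanced_points:
  assumes "compactin P2_top K" "K \<inter> coordinate_lines = {}"
  shows "\<exists>C. K \<subseteq> balanced_points C"
proof -
  have "K \<subseteq> P2" using compactin_subset_topspace[OF assms(1)] by (simp add: topspace_P2_top)
  then have "K \<subseteq> \<Union> (range balanced_points)" using assms(2) by (auto simp: coordinate_lines_def)
  moreover have "openin P2_top U" if "U \<in> range balanced_points" for U
    using that openin_balanced_points by (elim rangeE) simp
  ultimately have "\<exists>F. finite F \<and> F \<subseteq> range balanced_points \<and> K \<subseteq> \<Union>F"
    by (intro compactinD[OF assms(1)])
  then obtain F where F: "finite F" "F \<subseteq> range balanced_points" "K \<subseteq> \<Union>F"
    by (elim exE conjE)
  then obtain T where T: "finite T" "F = balanced_points ` T"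
    by (meson finite_subset_image)
  \<comment> \<open>The regions increase with C, so the largest index of the finite subcover
    suffices. Inserting 0 gives \<open>Max\<close> a nonempty set when \<open>T\<close> is
    empty.\<close>
  have "K \<subseteq> balanced_points (Max (insert 0 T))"
  proof
    fix x assume "x \<in> K"
    then obtain C where "C \<in> T" "x \<in> balanced_points C" using F(3) T(2) by auto
    then show "x \<in> balanced_points (Max (insert 0 T))"
      using T(1) balanced_points_mono[of C "Max (insert 0 T)"] by auto
  qed
  then show ?thesis by blast
qed

text \<open>As for \<open>Kul1\<close>, with a compact set in place of the base point: compactness
  puts it inside a single balanced region.\<close>

lemma Kul2_lattice:
  assumes "t > 0"
  shows "Kul2 (range (lattice_elt t)) \<subseteq> coordinate_lines"
  unfolding Kul2_def
proof (rule closure_of_minimal[OF _ closedin_coordinate_lines], rule subsetI, rule ccontr)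
  let ?G = "range (lattice_elt t)"
  fix q assume "q \<in> (\<Union>K\<in>{K. compactin P2_top K \<and> K \<subseteq> P2 - (Kul0 ?G \<union> Kul1 ?G)}. family_cluster ?G K)"
    and nq: "q \<notin> coordinate_lines"
  then obtain K where K: "compactin P2_top K" "K \<inter> coordinate_lines = {}" "q \<in> family_cluster ?G K"
    by (auto simp: Kul0_lattice[OF assms])
  have "q \<in> P2" using K(3) by (simp add: family_cluster_def)
  then obtain C C' where C: "q \<in> balanced_points C" "K \<subseteq> balanced_points C'"
    using compact_subset_balanced_points[OF K(1,2)] nq by (auto simp: coordinate_lines_def)
  then have qK: "q \<in> balanced_points (max C C')" "K \<subseteq> balanced_points (max C C')"
    using balanced_points_mono[of C "max C C'"] balanced_points_mono[of C' "max C C'"] by auto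
  then have "{g \<in> ?G. act g ` K \<inter> balanced_points (max C C') \<noteq> {}} \<subseteq>
      {g \<in> ?G. act g ` balanced_points (max C C') \<inter> balanced_points (max C C') \<noteq> {}}"
    by blast
  then have "finite {g \<in> ?G. act g ` K \<inter> balanced_points (max C C') \<noteq> {}}"
    using finite_balanced_returns[OF assms] by (meson finite_subset)
  then show False
    using K(3) qK(1) openin_balanced_points by (auto simp: family_cluster_def)
qed

lemma complex_kleinian_range_lattice_elt:
  assumes "t > 0"
  shows "complex_kleinian (range (lattice_elt t))"
proof -
  \<comment> \<open>All coordinates of [1:1:1] have equal modulus, so any constant above 1 would
    do.\<close>
  have bal: "balanced 2 (vec 1 :: complex^3)" by (simp add: balanced_def)
  have nz: "(vec 1 :: complex^3) \<noteq> 0" by (simp add: vec_eq_iff)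
  have "proj_point (vec 1) \<in> P2" using nz by (auto simp: P2_def)
  moreover have "proj_point (vec 1) \<notin> coordinate_lines"
    using bal by (auto simp: coordinate_lines_def balanced_points_def)
  ultimately have "proj_point (vec 1) \<in> Kul_domain (range (lattice_elt t))"
    using Kul1_lattice[OF assms] Kul2_lattice[OF assms]
    by (auto simp: Kul_domain_def Kul_limit_set_def Kul0_lattice[OF assms])
  then show ?thesis
    using discrete_range_lattice_elt[OF assms] by (auto simp: complex_kleinian_def)
qed

section \<open>Zariski density of classically open sets\<close>

text \<open>A predicate on functions, so that introduction rules show polynomiality without
  exhibiting the polynomial; \<open>poly\<close> returns only for the finiteness of the zero
  set.\<close>

definition polynomial_fun :: "(complex \<Rightarrow> complex) \<Rightarrow> bool" where
  "polynomial_fun f \<longleftrightarrow> (\<exists>q. f = poly q)"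

lemma polynomial_fun_const: "polynomial_fun (\<lambda>z. c)"
  unfolding polynomial_fun_def by (rule exI[of _ "[:c:]"]) auto

lemma polynomial_fun_ident: "polynomial_fun (\<lambda>z. z)"
  unfolding polynomial_fun_def by (rule exI[of _ "[:0, 1:]"]) auto

lemma polynomial_fun_add: "polynomial_fun f \<Longrightarrow> polynomial_fun g \<Longrightarrow> polynomial_fun (\<lambda>z. f z + g z)"
  unfolding polynomial_fun_def by (elim exE, hypsubst, rule exI, rule ext, rule poly_add[symmetric])

lemma polynomial_fun_diff: "polynomial_fun f \<Longrightarrow> polynomial_fun g \<Longrightarrow> polynomial_fun (\<lambda>z. f z - g z)"
  unfolding polynomial_fun_def by (elim exE, hypsubst, rule exI, rule ext, rule poly_diff[symmetric])

lemma polynomial_fun_mult: "polynomial_fun f \<Longrightarrow> polynomial_fun g \<Longrightarrow> polynomial_fun (\<lambda>z. f z * g z)"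
  unfolding polynomial_fun_def by (elim exE, hypsubst, rule exI, rule ext, rule poly_mult[symmetric])

lemma polynomial_fun_power: "polynomial_fun f \<Longrightarrow> polynomial_fun (\<lambda>z. f z ^ n)"
  unfolding polynomial_fun_def by (elim exE, hypsubst, rule exI, rule ext, rule poly_power[symmetric])

lemma polynomial_fun_prod: "(\<And>k. k \<in> S \<Longrightarrow> polynomial_fun (f k)) \<Longrightarrow> polynomial_fun (\<lambda>z. \<Prod>k\<in>S. f k z)"
  by (induction S rule: infinite_finite_induct)
    (auto intro: polynomial_fun_const polynomial_fun_mult)

lemmas polynomial_fun_intros =
  polynomial_fun_const polynomial_fun_ident polynomial_fun_add polynomial_fun_diff
  polynomial_fun_mult polynomial_fun_power polynomial_fun_prod

lemma polynomial_fun_det3: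
  fixes M :: "complex \<Rightarrow> mat3"
  shows "(\<And>i j. polynomial_fun (\<lambda>z. M z $ i $ j)) \<Longrightarrow> polynomial_fun (\<lambda>z. det (M z))"
  unfolding det_3 by (intro polynomial_fun_intros)

lemma continuous_on_polynomial_fun: "polynomial_fun f \<Longrightarrow> continuous_on S f"
  by (auto simp: polynomial_fun_def intro: continuous_intros)

lemma polynomial_fun_eq_0:
  assumes "polynomial_fun f" "infinite S" "\<And>z. z \<in> S \<Longrightarrow> f z = 0"
  shows "f z = 0"
proof -
  obtain q where q: "f = poly q" using assms(1) by (auto simp: polynomial_fun_def)
  have "q = 0"
  proof (rule ccontr)
    assume "q \<noteq> 0"
    then have "finite {z. poly q z = 0}" by (rule poly_roots_finite)
    then show False
      using assms(2,3) finite_subset[of S "{z. poly q z = 0}"] q by blast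
  qed
  then show ?thesis by (simp add: q)
qed

section \<open>The rational curve joining two tuples of matrices\<close>

definition mat_line :: "mat3 \<Rightarrow> mat3 \<Rightarrow> complex \<Rightarrow> mat3" where
  "mat_line A B z = (\<chi> i j. (1 - z) * A $ i $ j + z * B $ i $ j)"

text \<open>Only the first column is rescaled, so that no cube root is needed and the entries stay
  rational in those of \<open>A\<close>; the value is junk if \<open>det A = 0\<close>.\<close>
definition normalize_det :: "mat3 \<Rightarrow> mat3" where
  "normalize_det A = (\<chi> i j. if j = 1 then A $ i $ j / det A else A $ i $ j)"

lemma det_normalize_det:
  assumes "det A \<noteq> 0"
  shows "det (normalize_det A) = 1"
proof -
  \<comment> \<open>The divisor is generalized to \<open>d\<close> so that expanding determinants by
    \<open>det_3\<close> leaves it intact.\<close>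
  have "det (\<chi> i j. if j = 1 then A $ i $ j / d else A $ i $ j) = det A / d" for d
    by (simp add: det_3 add_divide_distrib diff_divide_distrib)
  then show ?thesis using assms by (simp add: normalize_det_def)
qed

lemma normalize_det_id: "det A = 1 \<Longrightarrow> normalize_det A = A"
  by (simp add: normalize_det_def vec_eq_iff)

lemma mat_line_0: "mat_line A B 0 = A" and mat_line_1: "mat_line A B 1 = B"
  by (simp_all add: mat_line_def vec_eq_iff)

lemma polynomial_fun_mat_line: "polynomial_fun (\<lambda>z. mat_line A B z $ i $ j)"
  unfolding mat_line_def by (auto intro!: polynomial_fun_intros)

lemma polynomial_fun_det_mat_line: "polynomial_fun (\<lambda>z. det (mat_line A B z))"
  by (intro polynomial_fun_det3 polynomial_fun_mat_line)

text \<open>The product \<open>D\<close> of all determinants is a common denominator for the entries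
  of the curve \<open>X\<close>, and each polynomial in them needs only a bounded power of it. The
  identity is claimed off the zeros of \<open>D\<close>, where no division by 0 occurs, but
  \<open>f\<close> is polynomial everywhere.\<close>

lemma entry_polynomial_clear_denominators:
  fixes A B :: "nat \<Rightarrow> mat3"
  assumes "entry_polynomial r p"
  defines "D \<equiv> \<lambda>z. \<Prod>k<r. det (mat_line (A k) (B k) z)"
    and "X \<equiv> \<lambda>z. \<lambda>k\<in>{..<r}. normalize_det (mat_line (A k) (B k) z)"
  shows "\<exists>m f. polynomial_fun f \<and>
    (\<forall>z. D z \<noteq> 0 \<longrightarrow> p (X z) * D z ^ m = f z)"
  using assms(1)
proof induction
  case (const c)
  then show ?case by (intro exI[of _ 0] exI[of _ "\<lambda>z. c"]) (simp add: polynomial_fun_const)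
next
  case (entry k i j)
  let ?M = "\<lambda>z. mat_line (A k) (B k) z"
  \<comment> \<open>In the first column, the factor of \<open>D\<close> belonging to k cancels the
    divisor and the other factors remain; other columns have no divisor. One power of
    \<open>D\<close> is enough.\<close>
  let ?f = "\<lambda>z. if j = 1 then ?M z $ i $ j * (\<Prod>l\<in>{..<r} - {k}. det (mat_line (A l) (B l) z)) else ?M z $ i $ j * D z"
  have "polynomial_fun ?f"
    unfolding D_def
    by (cases "j = 1") (auto intro!: polynomial_fun_intros polynomial_fun_mat_line polynomial_fun_det_mat_line)
  moreover have "X z k $ i $ j * D z ^ 1 = ?f z"
    if "D z \<noteq> 0" for z
  proof -
    have "D z = det (?M z) * (\<Prod>l\<in>{..<r} - {k}. det (mat_line (A l) (B l) z))"
      unfolding D_def using entry by (subst prod.remove[of _ k]) auto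
    then show ?thesis
      using that entry by (auto simp: X_def normalize_det_def)
  qed
  ultimately show ?case by blast
next
  case (add p q)
  then obtain m f n g where fg: "polynomial_fun f" "polynomial_fun g"
    "\<forall>z. D z \<noteq> 0 \<longrightarrow> p (X z) * D z ^ m = f z"
    "\<forall>z. D z \<noteq> 0 \<longrightarrow> q (X z) * D z ^ n = g z"
    by blast
  \<comment> \<open>Over the common denominator \<open>D z ^ (m + n)\<close>, each numerator is
    multiplied by the other one's denominator.\<close>
  have "polynomial_fun (\<lambda>z. f z * D z ^ n + g z * D z ^ m)"
    unfolding D_def by (intro polynomial_fun_intros fg polynomial_fun_det_mat_line)
  then show ?case
    using fg(3,4)
    by (intro exI[of _ "m + n"] exI[of _ "\<lambda>z. f z * D z ^ n + g z * D z ^ m"])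
      (auto simp: algebra_simps power_add)
next
  case (mult p q)
  then obtain m f n g where fg: "polynomial_fun f" "polynomial_fun g"
    "\<forall>z. D z \<noteq> 0 \<longrightarrow> p (X z) * D z ^ m = f z"
    "\<forall>z. D z \<noteq> 0 \<longrightarrow> q (X z) * D z ^ n = g z"
    by blast
  then show ?case
    by (intro exI[of _ "m + n"] exI[of _ "\<lambda>z. f z * g z"])
      (auto intro: polynomial_fun_mult simp: algebra_simps power_add)
qed

lemma classical_open_zariski_dense:
  assumes V: "openin (product_topology (\<lambda>_. PSL3_top) {..<r}) V" "V \<noteq> {}"
    and p: "entry_polynomial r p" and B: "B \<in> {..<r} \<rightarrow>\<^sub>E carrier SL3" "p B \<noteq> 0"
  shows "\<exists>C. C \<in> {..<r} \<rightarrow>\<^sub>E carrier SL3 \<and> p C \<noteq> 0 \<and> (\<lambda>i\<in>{..<r}. psl_class (C i)) \<in> V"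
proof (rule ccontr)
  assume neg: "\<nexists>C. C \<in> {..<r} \<rightarrow>\<^sub>E carrier SL3 \<and> p C \<noteq> 0 \<and> (\<lambda>i\<in>{..<r}. psl_class (C i)) \<in> V"
  obtain v where v: "v \<in> V" using V(2) by blast
  have vE: "v \<in> {..<r} \<rightarrow>\<^sub>E psl_class ` carrier SL3"
    using openin_subset[OF V(1)] v by (auto simp: topspace_PSL3_top carrier_PSL3)
  have "\<exists>A. det A = 1 \<and> v i = psl_class A" if "i < r" for i
  proof -
    have "v i \<in> psl_class ` carrier SL3" using vE that by auto
    then show ?thesis by (elim imageE) auto
  qed
  then obtain A where A: "\<And>i. i < r \<Longrightarrow> det (A i) = 1 \<and> v i = psl_class (A i)"
    by metis
  define D where "D z = (\<Prod>k<r. det (mat_line (A k) (B k) z))" for z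
  define X where "X z = (\<lambda>k\<in>{..<r}. normalize_det (mat_line (A k) (B k) z))" for z
  have "polynomial_fun (\<lambda>z. \<Prod>k<r. det (mat_line (A k) (B k) z))"
    by (intro polynomial_fun_prod polynomial_fun_det_mat_line)
  then have D_poly: "polynomial_fun D"
    by (simp add: D_def[abs_def])
  have detB: "det (B k) = 1" if "k < r" for k
    using PiE_mem[OF B(1), of k] that by simp
  have D0: "D 0 = 1" and D1: "D 1 = 1"
    using A detB by (auto simp: D_def mat_line_0 mat_line_1)
  have X0: "(\<lambda>k\<in>{..<r}. psl_class (X 0 k)) = v"
  proof
    fix k show "(\<lambda>k\<in>{..<r}. psl_class (X 0 k)) k = v k"
      using A[of k] vE by (cases "k < r") (auto simp: X_def mat_line_0 normalize_det_id)
  qed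
  have X1: "X 1 = B"
  proof
    fix k show "X 1 k = B k"
      using detB[of k] PiE_arb[OF B(1), of k]
      by (cases "k < r") (simp_all add: X_def mat_line_1 normalize_det_id)
  qed
  have det_nz: "det (mat_line (A k) (B k) z) \<noteq> 0" if "D z \<noteq> 0" "k < r" for k z
    using that by (auto simp: D_def)
  have X_mem: "X z \<in> {..<r} \<rightarrow>\<^sub>E carrier SL3" if "D z \<noteq> 0" for z
    using det_nz[OF that] by (auto simp: X_def det_normalize_det)
  \<comment> \<open>The curve lies in SL(3,C) for parameters in \<open>?S\<close>, which contains
    both ends 0 and 1.\<close>
  let ?S = "{z. D z \<noteq> 0}"
  have open_S: "open ?S"
    by (intro open_Collect_neq continuous_on_polynomial_fun D_poly continuous_on_const)
  have cont: "continuous_map (top_of_set ?S) (product_topology (\<lambda>_. PSL3_top) {..<r})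
      (\<lambda>z. \<lambda>k\<in>{..<r}. psl_class (X z k))"
    unfolding continuous_map_componentwise
  proof (intro conjI ballI)
    fix k assume k: "k \<in> {..<r}"
    have "continuous_on ?S (\<lambda>z. normalize_det (mat_line (A k) (B k) z))"
      unfolding normalize_det_def
    proof (intro continuous_on_vec_lambda)
      fix i j :: 3
      show "continuous_on ?S (\<lambda>z. if j = 1 then mat_line (A k) (B k) z $ i $ j / det (mat_line (A k) (B k) z)
              else mat_line (A k) (B k) z $ i $ j)"
      proof (cases "j = 1")
        case True
        have "continuous_on ?S (\<lambda>z. mat_line (A k) (B k) z $ i $ j / det (mat_line (A k) (B k) z))"
          using det_nz k by (intro continuous_on_divide continuous_on_polynomial_fun
              polynomial_fun_mat_line polynomial_fun_det_mat_line) simp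
        with True show ?thesis by simp
      next
        case False
        then show ?thesis
          by (simp add: continuous_on_polynomial_fun polynomial_fun_mat_line)
      qed
    qed
    then have "continuous_map (top_of_set ?S) (top_of_set (carrier SL3)) (\<lambda>z. normalize_det (mat_line (A k) (B k) z))"
      using det_nz k by (auto simp: det_normalize_det)
    then have "continuous_map (top_of_set ?S) PSL3_top (\<lambda>z. psl_class (normalize_det (mat_line (A k) (B k) z)))"
      unfolding PSL3_top_def
      by (rule continuous_map_compose[OF _ continuous_map_quotient_topology, unfolded o_def])
    then show "continuous_map (top_of_set ?S) PSL3_top (\<lambda>z. (\<lambda>k\<in>{..<r}. psl_class (X z k)) k)"
      using k by (simp add: X_def)
  qed auto
  define T where "T = {z \<in> ?S. (\<lambda>k\<in>{..<r}. psl_class (X z k)) \<in> V}"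
  have "openin (top_of_set ?S) T"
    using openin_continuous_map_preimage[OF cont V(1)] by (simp add: T_def)
  then have "open T" using open_S openin_open_trans by blast
  moreover have "0 \<in> T" using D0 X0 v by (simp add: T_def)
  \<comment> \<open>A nonempty open set of complex numbers is infinite, more than a nonzero
    polynomial has zeros.\<close>
  ultimately have "infinite T"
    using finite_imp_not_open by blast
  obtain m f where f: "polynomial_fun f" "\<And>z. D z \<noteq> 0 \<Longrightarrow> p (X z) * D z ^ m = f z"
    using entry_polynomial_clear_denominators[OF p, of A B] unfolding D_def X_def by blast
  have f0: "f z = 0" if zT: "z \<in> T" for z
  proof -
    have "p (X z) = 0"
    proof (rule ccontr)
      assume "p (X z) \<noteq> 0"
      with neg show False using zT X_mem[of z] unfolding T_def by blast
    qed
    then show ?thesis using f(2)[of z] zT by (simp add: T_def)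
  qed
  have "f 1 = 0" using polynomial_fun_eq_0[OF f(1) \<open>infinite T\<close>] f0 by blast
  \<comment> \<open>At the end 1 the denominator is 1 and the curve is at \<open>B\<close>, so
    \<open>f 1\<close> is \<open>p B\<close>.\<close>
  then show False using f(2)[of 1] D1 X1 B(2) by simp
qed

text \<open>The generating sets are closed under intersection, since a product of values is nonzero
  exactly when both factors are; so they form a basis.\<close>

lemma zariski_open_contains_basic:
  assumes "openin (SL3_power_zariski r) W" "B \<in> W"
  shows "\<exists>p. entry_polynomial r p \<and> p B \<noteq> 0 \<and> {A \<in> {..<r} \<rightarrow>\<^sub>E carrier SL3. p A \<noteq> 0} \<subseteq> W"
proof -
  have "generate_topology_on {{A \<in> {..<r} \<rightarrow>\<^sub>E carrier SL3. p A \<noteq> 0} | p. entry_polynomial r p} W"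
    using assms(1) unfolding SL3_power_zariski_def by (rule openin_topology_generated_by)
  then show ?thesis using assms(2)
  proof induction
    case (Int a b)
    then obtain p q where "entry_polynomial r p" "p B \<noteq> 0" "{A \<in> {..<r} \<rightarrow>\<^sub>E carrier SL3. p A \<noteq> 0} \<subseteq> a"
      "entry_polynomial r q" "q B \<noteq> 0" "{A \<in> {..<r} \<rightarrow>\<^sub>E carrier SL3. q A \<noteq> 0} \<subseteq> b"
      by blast
    then show ?case by (intro exI[of _ "\<lambda>A. p A * q A"]) (auto intro: entry_polynomial.mult)
  next
    case (UN K)
    then obtain k p where "k \<in> K" "entry_polynomial r p" "p B \<noteq> 0" "{A \<in> {..<r} \<rightarrow>\<^sub>E carrier SL3. p A \<noteq> 0} \<subseteq> k"
      by blast
    then show ?case by blast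
  qed auto
qed

lemma topspace_SL3_power_zariski: "topspace (SL3_power_zariski r) = {..<r} \<rightarrow>\<^sub>E carrier SL3"
proof -
  have "{..<r} \<rightarrow>\<^sub>E carrier SL3 \<in> {{A \<in> {..<r} \<rightarrow>\<^sub>E carrier SL3. p A \<noteq> 0} | p. entry_polynomial r p}"
    unfolding mem_Collect_eq by (rule exI[of _ "\<lambda>_. 1"]) (simp add: entry_polynomial.const)
  then show ?thesis
    unfolding SL3_power_zariski_def topology_generated_by_topspace
    by (intro subset_antisym Union_upper Union_least) blast+
qed

text \<open>Both topologies are pulled back from tuples of generator values. The argument climbs to
  tuples of lifts, where polynomials are defined, and returns through the universal property of the
  free group.\<close>

lemma classical_open_meets_zariski_open:
  assumes U: "openin (rep_top r) U" "U \<noteq> {}" and W: "openin (rep_zariski r) W" "W \<noteq> {}"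
  shows "U \<inter> W \<noteq> {}"
proof -
  obtain V where V: "openin (product_topology (\<lambda>_. PSL3_top) {..<r}) V" "U = gen_values r -` V \<inter> rep_space r"
    using U(1) by (auto simp: rep_top_def openin_pullback_topology)
  obtain V' where V': "openin (PSL3_power_zariski r) V'" "W = gen_values r -` V' \<inter> rep_space r"
    using W(1) by (auto simp: rep_zariski_def openin_pullback_topology)
  let ?q = "\<lambda>A. \<lambda>i\<in>{..<r}. psl_class (A i)"
  let ?O = "{A \<in> {..<r} \<rightarrow>\<^sub>E carrier SL3. ?q A \<in> V'}"
  have O: "openin (SL3_power_zariski r) ?O" "V' \<subseteq> ?q ` ({..<r} \<rightarrow>\<^sub>E carrier SL3)"
    using V'(1) unfolding PSL3_power_zariski_def openin_quotient_topology topspace_SL3_power_zariski by auto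
  obtain \<sigma> where "\<sigma> \<in> W" using W(2) by (meson ex_in_conv)
  then have "gen_values r \<sigma> \<in> V'" using V'(2) by simp
  moreover from this O(2) have "gen_values r \<sigma> \<in> ?q ` ({..<r} \<rightarrow>\<^sub>E carrier SL3)" by (rule subsetD[rotated])
  ultimately obtain B where B: "B \<in> ?O" by (elim imageE) simp
  obtain p where p: "entry_polynomial r p" "p B \<noteq> 0" "{A \<in> {..<r} \<rightarrow>\<^sub>E carrier SL3. p A \<noteq> 0} \<subseteq> ?O"
    using zariski_open_contains_basic[OF O(1) B] by (elim exE conjE)
  have "V \<noteq> {}" using U(2) V(2) by auto
  moreover have "B \<in> {..<r} \<rightarrow>\<^sub>E carrier SL3" using B by simp
  ultimately have "\<exists>C. C \<in> {..<r} \<rightarrow>\<^sub>E carrier SL3 \<and> p C \<noteq> 0 \<and> ?q C \<in> V"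
    by (rule classical_open_zariski_dense[OF V(1) _ p(1) _ p(2)])
  then obtain C where C: "C \<in> {..<r} \<rightarrow>\<^sub>E carrier SL3" "p C \<noteq> 0" "?q C \<in> V"
    by (elim exE conjE)
  then have "C \<in> ?O" by (intro subsetD[OF p(3)]) simp
  then have "?q C \<in> V'" by simp
  have "?q C \<in> {..<r} \<rightarrow>\<^sub>E carrier PSL3"
    using C(1) by (auto simp: carrier_PSL3 PiE_iff)
  then obtain \<rho> where "\<rho> \<in> rep_space r" "gen_values r \<rho> = ?q C"
    by (rule exists_rep_with_gen_values)
  then have "\<rho> \<in> U \<inter> W" using C(3) \<open>?q C \<in> V'\<close> V(2) V'(2) by simp
  then show ?thesis by auto
qed

section \<open>Schottky groups in the Zariski-Chabauty space\<close>

lemma schottky_locus_subset_kleinian_reps: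
  assumes "schottky_locus r U" "2 \<le> r"
  shows "U \<subseteq> kleinian_reps r"
proof
  fix \<rho> assume \<rho>: "\<rho> \<in> U"
  have "U \<subseteq> rep_space r"
    using assms(1) by (auto simp: schottky_locus_def rep_top_def openin_pullback_topology)
  then have "\<rho> \<in> rep_space r" using \<rho> by blast
  moreover have "complex_kleinian (rep_image r \<rho>)" "inj_on \<rho> (carrier (free_group r))"
    using assms(1) \<rho> by (auto simp: schottky_locus_def)
  \<comment> \<open>Faithfulness in rank at least 2 excludes virtually cyclic images; discreteness
    supplies the subgroup property.\<close>
  ultimately show "\<rho> \<in> kleinian_reps r"
    using rep_image_not_virtually_cyclic[of \<rho> r] assms(2)
    by (auto simp: kleinian_reps_def complex_kleinian_def discrete_subgroup_def)
qed

lemma schottky_groups_subset: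
  assumes "\<forall>r\<in>{2..d}. schottky_locus r (\<U> r)"
  shows "schottky_groups \<U> d \<subseteq> {G \<in> D_rank d. nu G = \<infinity>}"
proof
  fix G assume "G \<in> schottky_groups \<U> d"
  then obtain r \<rho> where r: "G = rep_image r \<rho>" "2 \<le> r" "r \<le> d" "\<rho> \<in> \<U> r"
    by (auto simp: schottky_groups_def)
  then have "schottky_locus r (\<U> r)" using assms by auto
  then show "G \<in> {G \<in> D_rank d. nu G = \<infinity>}"
    using schottky_locus_subset_kleinian_reps[of r "\<U> r"] r
    by (auto simp: D_rank_def schottky_locus_def)
qed

lemma D_rank_subset_D_fg: "D_rank d \<subseteq> D_fg"
  by (auto simp: D_rank_def D_fg_def)

text \<open>\<open>D_fg\<close> is open in the final topology because its preimage in each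
  \<open>kleinian_reps r\<close> with r at least 2 is everything.\<close>

lemma topspace_zariski_chabauty_top: "topspace zariski_chabauty_top = D_fg"
proof -
  have *: "{\<rho> \<in> topspace (subtopology (rep_zariski r) (kleinian_reps r)). rep_image r \<rho> \<in> D_fg} =
      topspace (subtopology (rep_zariski r) (kleinian_reps r))" if "2 \<le> r" for r
    using that by (auto simp: D_fg_def)
  have "openin zariski_chabauty_top D_fg"
    unfolding zariski_chabauty_top_def openin_final_topology
  proof (intro conjI ballI subset_refl)
    fix r :: nat assume "r \<in> {2..}"
    then show "openin (subtopology (rep_zariski r) (kleinian_reps r))
        {\<rho> \<in> topspace (subtopology (rep_zariski r) (kleinian_reps r)). rep_image r \<rho> \<in> D_fg}"
      by (subst *) (simp_all only: atLeast_iff openin_topspace)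
  qed
  moreover have "topspace zariski_chabauty_top \<subseteq> D_fg"
    using openin_topspace[of zariski_chabauty_top]
    unfolding zariski_chabauty_top_def openin_final_topology by auto
  ultimately show ?thesis using openin_subset by blast
qed

text \<open>Generator values have lifts to SL(3,C). Hence the restriction to \<open>topspace\<close>
  in the final topology discards no representation.\<close>

lemma kleinian_reps_subset_topspace: "kleinian_reps r \<subseteq> topspace (rep_zariski r)"
proof
  fix \<rho> assume "\<rho> \<in> kleinian_reps r"
  then have \<rho>: "\<rho> \<in> rep_space r" by (simp add: kleinian_reps_def)
  have "gen_values r \<rho> \<in> (\<lambda>A. \<lambda>i\<in>{..<r}. psl_class (A i)) ` ({..<r} \<rightarrow>\<^sub>E carrier SL3)"
  proof -
    have "\<exists>A. det A = 1 \<and> \<rho> (gen i) = psl_class A" if "i < r" for i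
    proof -
      have "\<rho> (gen i) \<in> psl_class ` carrier SL3"
        using rep_space_closed[OF \<rho>, of "gen i"] that by (simp add: gen_def letters_def carrier_PSL3)
      then show ?thesis by (elim imageE) auto
    qed
    then obtain A where A: "\<And>i. i < r \<Longrightarrow> det (A i) = 1 \<and> \<rho> (gen i) = psl_class (A i)"
      by metis
    show ?thesis
      by (rule image_eqI[of _ _ "restrict A {..<r}"]) (use A in \<open>auto simp: gen_values_def intro!: restrict_ext\<close>)
  qed
  then show "\<rho> \<in> topspace (rep_zariski r)"
    using \<rho> by (simp add: rep_zariski_def topspace_pullback_topology PSL3_power_zariski_def
        topspace_quotient_topology topspace_SL3_power_zariski)
qed

text \<open>A group is approximated by Schottky groups of the same rank r that presents it. Because
  the Schottky locus lies in \<open>kleinian_reps r\<close>, its intersection with the ambient open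
  set \<open>X\<close> falls back into the preimage of \<open>W\<close>.\<close>

lemma schottky_groups_dense:
  assumes "\<forall>r\<in>{2..d}. schottky_locus r (\<U> r)"
  shows "D_rank d \<subseteq> subtopology zariski_chabauty_top (D_rank d) closure_of schottky_groups \<U> d"
proof
  fix G assume G: "G \<in> D_rank d"
  then obtain r \<rho> where r: "G = rep_image r \<rho>" "2 \<le> r" "r \<le> d" "\<rho> \<in> kleinian_reps r"
    by (auto simp: D_rank_def)
  have locus: "schottky_locus r (\<U> r)" using assms r by auto
  have "\<exists>H. H \<in> schottky_groups \<U> d \<and> H \<in> W \<inter> D_rank d"
    if W: "openin zariski_chabauty_top W" "G \<in> W" for W
  proof -
    have "openin (subtopology (rep_zariski r) (kleinian_reps r))
        {\<rho> \<in> topspace (subtopology (rep_zariski r) (kleinian_reps r)). rep_image r \<rho> \<in> W}"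
      using W(1) r(2) unfolding zariski_chabauty_top_def openin_final_topology by auto
    then obtain X where X: "openin (rep_zariski r) X"
      "{\<rho> \<in> topspace (subtopology (rep_zariski r) (kleinian_reps r)). rep_image r \<rho> \<in> W} = X \<inter> kleinian_reps r"
      by (auto simp: openin_subtopology)
    have "\<rho> \<in> X" using X(2) W(2) r kleinian_reps_subset_topspace[of r] by (auto simp: topspace_subtopology)
    then obtain \<sigma> where \<sigma>: "\<sigma> \<in> \<U> r" "\<sigma> \<in> X"
      using classical_open_meets_zariski_open[OF _ _ X(1), of "\<U> r"] locus by (auto simp: schottky_locus_def)
    then have "\<sigma> \<in> X \<inter> kleinian_reps r"
      using schottky_locus_subset_kleinian_reps[OF locus r(2)] by blast
    then have "rep_image r \<sigma> \<in> W" using X(2) by blast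
    moreover have "rep_image r \<sigma> \<in> schottky_groups \<U> d"
      using \<sigma>(1) r by (auto simp: schottky_groups_def)
    ultimately show ?thesis using schottky_groups_subset[OF assms] by blast
  qed
  then show "G \<in> subtopology zariski_chabauty_top (D_rank d) closure_of schottky_groups \<U> d"
    using G D_rank_subset_D_fg[of d]
    by (auto simp: in_closure_of topspace_subtopology topspace_zariski_chabauty_top openin_subtopology)
qed

theorem corollary6p4:
  fixes N :: "psl set" and t :: real and \<rho>0 :: rep and G0 :: "psl set" and \<U> :: "nat \<Rightarrow> rep set"
  assumes N: "zassenhaus_nbhd N"
    and t: "t > 0"
      "psl_class (diag3 (of_real (exp t)) (of_real (exp (- t))) 1) \<in> N"
      "psl_class (diag3 1 (of_real (exp t)) (of_real (exp (- t)))) \<in> N"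
    and \<rho>0: "\<rho>0 \<in> rep_space 2"
      "\<rho>0 (gen 0) = psl_class (diag3 (of_real (exp t)) (of_real (exp (- t))) 1)"
      "\<rho>0 (gen 1) = psl_class (diag3 1 (of_real (exp t)) (of_real (exp (- t))))"
    and G0: "G0 = rep_image 2 \<rho>0"
    and \<U>: "schottky_locus 2 (\<U> 2)"
  shows "sub_psl G0 \<cong> integer_group \<times>\<times> integer_group \<and>
    \<not> (\<exists>\<rho> :: nat \<Rightarrow> rep. (\<forall>j. \<rho> j \<in> \<U> 2) \<and> converges_strongly (\<lambda>j. rep_image 2 (\<rho> j)) G0) \<and>
    G0 \<in> D_rank 2 \<and>
    (\<forall>d\<ge>2. (\<forall>r\<in>{2..d}. schottky_locus r (\<U> r)) \<longrightarrow>
       schottky_groups \<U> d \<subseteq> {G \<in> D_rank d. nu G = \<infinity>} \<and>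
       subtopology zariski_chabauty_top (D_rank d) closure_of schottky_groups \<U> d = D_rank d \<and>
       subtopology zariski_chabauty_top (D_rank d) closure_of {G \<in> D_rank d. nu G = \<infinity>} = D_rank d \<and>
       \<not> (\<forall>G \<in> D_rank d. \<exists>Gs. (\<forall>j. Gs j \<in> schottky_groups \<U> d) \<and> converges_strongly Gs G))"
proof -
  have G: "G0 = range (lattice_elt t)"
    unfolding G0 using \<rho>0 by (rule rep_image_eq_range_lattice_elt)
  have iso: "sub_psl G0 \<cong> integer_group \<times>\<times> integer_group"
    unfolding G using t(1) by (rule range_lattice_elt_iso)
  have abel: "x \<otimes>\<^bsub>PSL3\<^esub> y = y \<otimes>\<^bsub>PSL3\<^esub> x" if "x \<in> G0" "y \<in> G0" for x y
    using that unfolding G by (rule lattice_elt_commute)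
  have nonabel: "\<exists>x\<in>rep_image r \<sigma>. \<exists>y\<in>rep_image r \<sigma>. x \<otimes>\<^bsub>PSL3\<^esub> y \<noteq> y \<otimes>\<^bsub>PSL3\<^esub> x"
    if "schottky_locus r (\<U> r)" "2 \<le> r" "\<sigma> \<in> \<U> r" for r \<sigma>
  proof -
    have "\<sigma> \<in> kleinian_reps r" using schottky_locus_subset_kleinian_reps[OF that(1,2)] that(3) by (rule subsetD)
    then have "\<sigma> \<in> rep_space r" by (simp add: kleinian_reps_def)
    moreover have "inj_on \<sigma> (carrier (free_group r))" using that(1,3) by (simp add: schottky_locus_def)
    ultimately show ?thesis using that(2) by (rule rep_image_not_abelian)
  qed
  have not_limit: "\<not> converges_strongly (\<lambda>j. rep_image 2 (\<rho> j)) G0" if "\<forall>j. \<rho> j \<in> \<U> 2" for \<rho>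
    using abel nonabel[OF \<U>] that by (intro not_converges_strongly_if_abelian) simp_all
  have "\<rho>0 \<in> kleinian_reps 2"
    using complex_kleinian_range_lattice_elt[OF t(1)] range_lattice_elt_not_virtually_cyclic[OF t(1)] \<rho>0(1)
    by (simp add: kleinian_reps_def G[unfolded G0])
  then have D: "G0 \<in> D_rank d" if "2 \<le> d" for d
    using that unfolding D_rank_def G0 mem_Collect_eq by (intro exI[of _ 2] exI[of _ \<rho>0]) simp
  have rest: "schottky_groups \<U> d \<subseteq> {G \<in> D_rank d. nu G = \<infinity>} \<and>
       subtopology zariski_chabauty_top (D_rank d) closure_of schottky_groups \<U> d = D_rank d \<and>
       subtopology zariski_chabauty_top (D_rank d) closure_of {G \<in> D_rank d. nu G = \<infinity>} = D_rank d \<and>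
       \<not> (\<forall>G \<in> D_rank d. \<exists>Gs. (\<forall>j. Gs j \<in> schottky_groups \<U> d) \<and> converges_strongly Gs G)"
    if d: "2 \<le> d" and loci: "\<forall>r\<in>{2..d}. schottky_locus r (\<U> r)" for d
  proof (intro conjI)
    let ?X = "subtopology zariski_chabauty_top (D_rank d)"
    show sub: "schottky_groups \<U> d \<subseteq> {G \<in> D_rank d. nu G = \<infinity>}"
      using loci by (rule schottky_groups_subset)
    have dense: "D_rank d \<subseteq> ?X closure_of schottky_groups \<U> d"
      using loci by (rule schottky_groups_dense)
    have le: "?X closure_of S \<subseteq> D_rank d" for S
      using closure_of_subset_topspace[of ?X S] by (simp add: topspace_subtopology)
    show "?X closure_of schottky_groups \<U> d = D_rank d"
      by (rule subset_antisym[OF le dense])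
    show "?X closure_of {G \<in> D_rank d. nu G = \<infinity>} = D_rank d"
      \<comment> \<open>The groups with infinite \<open>nu\<close> include the Schottky groups, so
        their closure is at least as large.\<close>
      by (rule subset_antisym[OF le subset_trans[OF dense closure_of_mono[OF sub]]])
    have "\<not> converges_strongly Gs G0" if Gs: "\<forall>j. Gs j \<in> schottky_groups \<U> d" for Gs
    proof (rule not_converges_strongly_if_abelian[OF abel])
      fix j
      \<comment> \<open>The rank is chosen for each j separately; noncommutativity holds in all of
        them.\<close>
      obtain r \<sigma> where "Gs j = rep_image r \<sigma>" "2 \<le> r" "r \<le> d" "\<sigma> \<in> \<U> r"
        using Gs[rule_format, of j] unfolding schottky_groups_def mem_Collect_eq by (elim exE conjE)
      then show "\<exists>x\<in>Gs j. \<exists>y\<in>Gs j. x \<otimes>\<^bsub>PSL3\<^esub> y \<noteq> y \<otimes>\<^bsub>PSL3\<^esub> x"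
        using nonabel[of r \<sigma>] loci by simp
    qed
    then show "\<not> (\<forall>G \<in> D_rank d. \<exists>Gs. (\<forall>j. Gs j \<in> schottky_groups \<U> d) \<and> converges_strongly Gs G)"
      using D[OF d] by metis
  qed
  show ?thesis
  proof (intro conjI allI impI)
    show "\<nexists>\<rho>. (\<forall>j. \<rho> j \<in> \<U> 2) \<and> converges_strongly (\<lambda>j. rep_image 2 (\<rho> j)) G0"
    proof
      assume "\<exists>\<rho>. (\<forall>j. \<rho> j \<in> \<U> 2) \<and> converges_strongly (\<lambda>j. rep_image 2 (\<rho> j)) G0"
      then obtain \<rho> where \<rho>: "\<forall>j. \<rho> j \<in> \<U> 2" "converges_strongly (\<lambda>j. rep_image 2 (\<rho> j)) G0"
        by (elim exE conjE)
      show False using not_limit[OF \<rho>(1)] \<rho>(2) by (rule notE)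
    qed
  qed (use iso D[of 2] rest in simp_all)
qed

end
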